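(* Let $1 \le k \le n$ be integers. Let $V_{n,k}$ be the Stiefel manifold of $k$-tuples $(x_1,\dots,x_k)$ of pairwise orthonormal vectors in $\mathbb{R}^n$, and let $(\mathbb{Z}/2)^k$, with standard generators $\varepsilon_1,\dots,\varepsilon_k$, act on $V_{n,k}$ by letting $\varepsilon_j$ act as $(x_1,\dots,x_j,\dots,x_k)\mapsto(x_1,\dots,-x_j,\dots,x_k)$. Let $(\mathbb{Z}/2)^k$ act linearly on $\mathbb{R}^{n-1}\oplus\mathbb{R}^{n-2}\oplus\dots\oplus\mathbb{R}^{n-k}$ by letting $\varepsilon_j$ act as multiplication by $-1$ on the $j$th summand $\mathbb{R}^{n-j}$ and as the identity on all other summands. Then every continuous $(\mathbb{Z}/2)^k$-equivariant map $$V_{n,k}\longrightarrow \mathbb{R}^{n-1}\oplus\mathbb{R}^{n-2}\oplus\dots\oplus\mathbb{R}^{n-k}$$ has a zero.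
   Context: $V_{n,k}$ is viewed as a subspace of $(S^{n-1})^k\subset(\mathbb{R}^n)^k$. The space $\mathbb{R}^0$ is the zero vector space. *)

theory Defs
  imports "HOL-Analysis.Analysis" "HOL-Algebra.Product_Groups"
begin

text \<open>
  Dimensions vary with \<open>n\<close> and \<open>j\<close>, so the spaces are abstract topologies built from
  \<^const>\<open>Euclidean_space\<close> and \<^const>\<open>nsphere\<close>, whose points are functions \<open>nat \<Rightarrow> real\<close>
  vanishing from the dimension on (\<open>Euclidean_space 0\<close> is the zero space). A tuple
  \<open>(x\<^sub>1, \<dots>, x\<^sub>k)\<close> is a function extensional on \<open>{1..k}\<close>; coordinates of vectors count from 0.
\<close>

text \<open>The unit sphere of \<open>\<real>\<^sup>n\<close> is \<open>nsphere (n - 1)\<close>, which accounts for the unit length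
  of the vectors; \<open>n \<ge> 1\<close> is required for this to be meaningful.\<close>

definition Stiefel :: "nat \<Rightarrow> nat \<Rightarrow> (nat \<Rightarrow> nat \<Rightarrow> real) topology" where
  "Stiefel n k =
     subtopology (product_topology (\<lambda>_. nsphere (n - 1)) {1..k})
       {x. \<forall>i\<in>{1..k}. \<forall>j\<in>{1..k}. i \<noteq> j \<longrightarrow> (\<Sum>l<n. x i l * x j l) = 0}"

definition Stiefel_target :: "nat \<Rightarrow> nat \<Rightarrow> (nat \<Rightarrow> nat \<Rightarrow> real) topology" where
  "Stiefel_target n k = product_topology (\<lambda>j. Euclidean_space (n - j)) {1..k}"

definition Z2_power :: "nat \<Rightarrow> (nat \<Rightarrow> int) monoid" where
  "Z2_power k = product_group {1..k} (\<lambda>_. integer_mod_group 2)"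

definition Z2_gen :: "nat \<Rightarrow> nat \<Rightarrow> nat \<Rightarrow> int" where
  "Z2_gen k j = (\<lambda>i\<in>{1..k}. if i = j then 1 else 0)"

text \<open>The same formula gives the action on \<^const>\<open>Stiefel\<close> and on \<^const>\<open>Stiefel_target\<close>.\<close>

definition sign_action :: "nat \<Rightarrow> (nat \<Rightarrow> int) \<Rightarrow> (nat \<Rightarrow> nat \<Rightarrow> real) \<Rightarrow> nat \<Rightarrow> nat \<Rightarrow> real" where
  "sign_action k g x = (\<lambda>j\<in>{1..k}. \<lambda>l. (-1) ^ nat (g j) * x j l)"

definition Z2_equivariant ::
    "nat \<Rightarrow> (nat \<Rightarrow> nat \<Rightarrow> real) set \<Rightarrow> ((nat \<Rightarrow> nat \<Rightarrow> real) \<Rightarrow> nat \<Rightarrow> nat \<Rightarrow> real) \<Rightarrow> bool" where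
  "Z2_equivariant k V f \<longleftrightarrow>
     (\<forall>g\<in>carrier (Z2_power k). \<forall>x\<in>V. f (sign_action k g x) = sign_action k g (f x))"

lemma topspace_Stiefel:
  assumes "1 \<le> n"
  shows "topspace (Stiefel n k) =
    {x \<in> {1..k} \<rightarrow>\<^sub>E topspace (Euclidean_space n).
       \<forall>i\<in>{1..k}. \<forall>j\<in>{1..k}. (\<Sum>l<n. x i l * x j l) = (if i = j then 1 else 0)}"
proof -
  have "{..n - 1} = {..<n}"
    using assms by auto
  then have "topspace (nsphere (n - 1)) =
      {v \<in> topspace (Euclidean_space n). (\<Sum>l<n. v l * v l) = 1}"
    using assms by (auto simp: nsphere_def power2_eq_square)
  then show ?thesis
    unfolding Stiefel_def by (auto simp: PiE_iff extensional_def)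
qed

lemma Z2_gen_in_carrier: "Z2_gen k j \<in> carrier (Z2_power k)"
  by (auto simp: Z2_power_def Z2_gen_def carrier_integer_mod_group)

lemma sign_action_gen:
  assumes "x \<in> extensional {1..k}" "j \<in> {1..k}"
  shows "sign_action k (Z2_gen k j) x = x(j := (\<lambda>l. - x j l))"
  using assms by (auto simp: sign_action_def Z2_gen_def fun_eq_iff extensional_def)

lemma sign_action_one:
  assumes "x \<in> extensional {1..k}"
  shows "sign_action k \<one>\<^bsub>Z2_power k\<^esub> x = x"
  using assms by (auto simp: sign_action_def Z2_power_def fun_eq_iff extensional_def)

lemma sign_action_mult:
  assumes "g \<in> carrier (Z2_power k)" "h \<in> carrier (Z2_power k)"
  shows "sign_action k (g \<otimes>\<^bsub>Z2_power k\<^esub> h) x = sign_action k g (sign_action k h x)"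
proof -
  have "(-1) ^ nat ((g j + h j) mod 2) = (-1 :: real) ^ nat (g j) * (-1) ^ nat (h j)"
    if "j \<in> {1..k}" for j
  proof -
    have "g j \<in> {0..<2}" "h j \<in> {0..<2}"
      using assms that by (auto simp: Z2_power_def PiE_iff carrier_integer_mod_group)
    then have "(g j = 0 \<or> g j = 1) \<and> (h j = 0 \<or> h j = 1)"
      by auto
    then show ?thesis
      by auto
  qed
  then show ?thesis
    by (simp add: sign_action_def Z2_power_def fun_eq_iff)
qed

lemma sign_action_Stiefel:
  assumes "1 \<le> n" "x \<in> topspace (Stiefel n k)"
  shows "sign_action k g x \<in> topspace (Stiefel n k)"
proof -
  have "(\<Sum>l<n. ((-1) ^ a * u l) * ((-1) ^ b * v l)) = (-1) ^ a * (-1) ^ b * (\<Sum>l<n. u l * v l)"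
    for a b and u v :: "nat \<Rightarrow> real"
    by (simp add: sum_distrib_left mult_ac)
  moreover have "(-1) ^ a * (-1) ^ a = (1 :: real)" for a :: nat
    by (simp flip: power_mult_distrib)
  ultimately show ?thesis
    using assms by (auto simp: topspace_Stiefel sign_action_def PiE_iff extensional_def topspace_Euclidean_space)
qed

lemma sign_action_Stiefel_target:
  assumes "x \<in> topspace (Stiefel_target n k)"
  shows "sign_action k g x \<in> topspace (Stiefel_target n k)"
  using assms
  by (auto simp: Stiefel_target_def sign_action_def PiE_iff extensional_def topspace_Euclidean_space)

end

theory Submission
  imports Defs "HOL-Library.Z2"
begin

text \<open>
  The manifold \<open>V\<^bsub>n,k\<^esub>\<close> is the set of common zeros, in the product of \<open>k\<close> spheres \<open>S\<^bsup>n-1\<^esup>\<close>, of the inner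
  products \<open>x\<^sub>p \<bullet> x\<^sub>q\<close> with \<open>p < q\<close>. After a Tietze extension of the components of \<open>f\<close>, one needs a common
  zero of \<open>k (n - 1)\<close> real functions on this product, one for each \<open>q \<le> k\<close> and \<open>l < n - 1\<close>, where the
  function indexed by \<open>(q, l)\<close> changes sign under \<open>\<epsilon>\<^sub>q\<close> and possibly under some \<open>\<epsilon>\<^sub>p\<close> with \<open>p < q\<close>.

  The signs of such functions on the barycenters of a fine cubical subdivision define 1-cocycles
  modulo 2 on the quotient by the sign group. Their cup product, evaluated on the fundamental class,
  counts the flags along whose \<open>i\<close>-th step the \<open>i\<close>-th sign changes; modulo 2 this number depends only on
  the characters of the functions. For the functions \<open>x\<^bsub>q,l\<^esub> \<Prod>\<^sub>p x\<^bsub>p,n-1\<^esub>\<close> it is 1. Hence every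
  subdivision has a small flag on which all functions change sign, and a limit of such flags is a
  common zero.
\<close>

section \<open>Cochains modulo 2\<close>

text \<open>\<^theory>\<open>HOL-Library.Z2\<close> normalizes sums and products to bit operations by default, which
  blocks ring reasoning.\<close>

declare add_bit_eq_xor [simp del] mult_bit_eq_and [simp del]

lemma bit_add_self [simp]: "x + x = 0" "x + (x + y) = y" for x y :: bit
  by (cases x; cases y; simp)+

lemma bit_add_eq_0_iff: "x + y = 0 \<longleftrightarrow> x = y" for x y :: bit
  by (cases x; cases y) auto

text \<open>The involution has no fixed points, so the terms cancel in pairs; the induction removes
  one pair at a time.\<close>

lemma sum_involution_bit:
  fixes f :: "'a \<Rightarrow> bit"
  assumes "finite A"
    and "\<And>x. x \<in> A \<Longrightarrow> g x \<in> A" "\<And>x. x \<in> A \<Longrightarrow> g (g x) = x"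
    and "\<And>x. x \<in> A \<Longrightarrow> g x \<noteq> x" "\<And>x. x \<in> A \<Longrightarrow> f (g x) = f x"
  shows "sum f A = 0"
  using assms
proof (induction "card A" arbitrary: A rule: less_induct)
  case less
  show ?case
  proof (cases "A = {}")
    case False
    then obtain x where x: "x \<in> A"
      by blast
    let ?B = "A - {x, g x}"
    have "sum f ?B = 0"
    proof (rule less.hyps)
      show "card ?B < card A"
        using less.prems(1) x by (intro psubset_card_mono) auto
      show "g y \<in> ?B" if "y \<in> ?B" for y
        using that less.prems(2,3) x by (metis Diff_iff insert_iff empty_iff)
    qed (use less.prems in auto)
    moreover have "sum f A = sum f ?B + sum f {x, g x}"
      using less.prems(1,2) x by (subst sum.subset_diff[of "{x, g x}" A]) auto
    moreover have "sum f {x, g x} = 0"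
      using less.prems(4,5)[OF x] by (simp add: eq_commute[of x])
    ultimately show ?thesis
      by simp
  qed auto
qed

section \<open>Cup products and coboundary on ordered simplices\<close>

type_synonym 'a cochain = "'a list \<Rightarrow> bit"

text \<open>The functions \<open>cup0 h\<close> and \<open>cup1 a\<close> are the cup products with the 0-cochain \<open>h\<close> and with the
  1-cochain \<open>\<delta>a\<close> on ordered simplices; values on lists that are too short are junk.\<close>

fun cup0 :: "('a \<Rightarrow> bit) \<Rightarrow> 'a cochain \<Rightarrow> 'a cochain" where
  "cup0 h c [] = 0"
| "cup0 h c (v # vs) = h v * c (v # vs)"

fun cup1 :: "('a \<Rightarrow> bit) \<Rightarrow> 'a cochain \<Rightarrow> 'a cochain" where
  "cup1 a c (v # w # vs) = (a v + a w) * c (w # vs)"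
| "cup1 a c _ = 0"

text \<open>The recursion deletes the first vertex or keeps it. It runs parallel to those of the cup
  products, so that Leibniz rules become computations with the leading vertices.\<close>

fun coboundary :: "'a cochain \<Rightarrow> 'a cochain" where
  "coboundary c [] = 0"
| "coboundary c (v # vs) = c vs + coboundary (\<lambda>ws. c (v # ws)) vs"

definition cups :: "('a \<Rightarrow> bit) list \<Rightarrow> 'a cochain \<Rightarrow> 'a cochain" where
  "cups ss c = foldr cup1 ss c"

lemma cups_simps [simp]: "cups [] c = c" "cups (s # ss) c = cup1 s (cups ss c)"
  by (simp_all add: cups_def)

lemma cups_append: "cups (ss @ ts) c = cups ss (cups ts c)"
  by (simp add: cups_def)

lemma coboundary_eq_sum:
  "coboundary c vs = (\<Sum>j<length vs. c (take j vs @ drop (Suc j) vs))"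
  by (induction c vs rule: coboundary.induct) (auto simp: sum.lessThan_Suc_shift simp del: sum.lessThan_Suc)

lemma coboundary_scale: "coboundary (\<lambda>ws. a * c ws) vs = a * coboundary c vs"
  by (induction c vs rule: coboundary.induct) (auto simp: algebra_simps)

text \<open>Leibniz rule for the product with the cocycle \<open>\<delta>a\<close>. On a list of
  length 2 the right side would involve the junk value \<open>c []\<close>.\<close>

lemma coboundary_cup1:
  assumes "3 \<le> length vs"
  shows "coboundary (cup1 a c) vs = cup1 a (coboundary c) vs"
proof -
  obtain v w u us where "vs = v # w # u # us"
    using assms by (metis Suc_le_length_iff numeral_3_eq_3)
  moreover have "(a w + a u) * x + ((a v + a u) * x + (a v + a w) * y) = (a v + a w) * (x + y)"
    for x y
    by (cases "a v"; cases "a w"; cases "a u"; cases x; cases y) auto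
  ultimately show ?thesis
    by (simp add: coboundary_scale)
qed

lemma coboundary_cups:
  assumes "length ss + 2 \<le> length vs"
  shows "coboundary (cups ss c) vs = cups ss (coboundary c) vs"
  using assms
proof (induction ss arbitrary: vs)
  case (Cons s ss)
  then obtain v w us where vs: "vs = v # w # us"
    by (metis Suc_le_length_iff add_2_eq_Suc' length_Cons numeral_2_eq_2 Suc_leD)
  have "coboundary (cup1 s (cups ss c)) vs = cup1 s (coboundary (cups ss c)) vs"
    using Cons.prems by (intro coboundary_cup1) simp
  also have "\<dots> = cup1 s (cups ss (coboundary c)) vs"
    using Cons.prems Cons.IH[of "w # us"] by (simp add: vs)
  finally show ?case
    by simp
qed simp

lemma cups_zero [simp]: "cups ss (\<lambda>_. 0) vs = 0"
  by (induction ss arbitrary: vs) (auto, metis cup1.elims mult_zero_right)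

text \<open>Each \<open>cup1\<close> drops one vertex, so \<open>c\<close> only sees the last
  \<open>m\<close> entries; \<open>0 < m\<close> ensures that no \<open>cup1\<close> meets a list
  that is too short.\<close>

lemma cups_cong:
  assumes "length vs = length ss + m" "\<And>ws. length ws = m \<Longrightarrow> c ws = d ws" "0 < m"
  shows "cups ss c vs = cups ss d vs"
  using assms(1)
proof (induction ss arbitrary: vs)
  case (Cons s ss)
  then obtain v w us where "vs = v # w # us"
    using assms(3) by (cases vs; cases "tl vs") auto
  then show ?case
    using Cons by simp
qed (use assms in auto)

text \<open>A product of cocycles is a cocycle: the coboundary moves onto the constant 1, where the
  two ends of an edge cancel.\<close>

lemma coboundary_cups_one:
  assumes "length vs = length ss + 2"
  shows "coboundary (cups ss (\<lambda>_. 1)) vs = 0"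
proof -
  have "coboundary (\<lambda>_. 1) ws = 0" if "length ws = 2" for ws :: "'a list"
    using that by (auto simp: length_Suc_conv numeral_2_eq_2)
  then have "cups ss (coboundary (\<lambda>_. 1)) vs = cups ss (\<lambda>_. 0) vs"
    using assms by (intro cups_cong[where m = 2]) auto
  then show ?thesis
    using assms by (simp add: coboundary_cups)
qed

text \<open>The Leibniz rule has a second term, \<open>h\<close> times the coboundary of
  \<open>c\<close>, which the assumption removes. The product with \<open>\<delta>h\<close> is
  thereby a coboundary.\<close>

lemma coboundary_cup0:
  assumes "2 \<le> length vs" "coboundary c vs = 0"
  shows "coboundary (cup0 h c) vs = cup1 h c vs"
proof -
  obtain v w us where vs: "vs = v # w # us"
    using assms(1) by (metis Suc_le_length_iff numeral_2_eq_2)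
  have "coboundary (\<lambda>ws. c (v # ws)) (w # us) = c (w # us)"
    using assms(2) unfolding vs coboundary.simps(2)[of c v] bit_add_eq_0_iff by simp
  then show ?thesis
    by (simp add: vs coboundary_scale algebra_simps)
qed

section \<open>A cubical model of a product of spheres\<close>

text \<open>An index \<open>(p, l)\<close> is coordinate \<open>l\<close> of vector
  \<open>p\<close>; the set \<open>S\<close> encodes the product of the generators with index in
  \<open>S\<close>.\<close>

definition flip :: "nat set \<Rightarrow> (nat \<times> nat \<Rightarrow> int) \<Rightarrow> nat \<times> nat \<Rightarrow> int" where
  "flip S v = (\<lambda>i. if fst i \<in> S then - v i else v i)"

lemma flip_flip: "flip A (flip B v) = flip (sym_diff A B) v"
  by (auto simp: flip_def fun_eq_iff)

lemma flip_empty [simp]: "flip {} v = v"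
  by (simp add: flip_def)

lemma flip_flip_same [simp]: "flip A (flip A v) = v"
  by (auto simp: flip_def)

definition face :: "nat \<Rightarrow> 'a list \<Rightarrow> 'a list" where
  "face j vs = take j vs @ drop (Suc j) vs"

lemma face_list_update [simp]: "face j (vs[j := x]) = face j vs"
  by (simp add: face_def)

lemma face_map: "face j (map f vs) = map f (face j vs)"
  by (simp add: face_def take_map drop_map)

lemma set_face: "set (face j vs) \<subseteq> set vs"
  by (auto simp: face_def dest: in_set_takeD in_set_dropD)

text \<open>\<open>M\<close> is even so that the extreme values \<open>M\<close> and
  \<open>-M\<close> belong to vertices, never to open edges.\<close>

locale cube_grid =
  fixes n k :: nat and M :: int
  assumes n: "1 \<le> n" and M: "even M" "2 \<le> M"
begin

definition I :: "(nat \<times> nat) set" where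
  "I = {1..k} \<times> {..<n}"

text \<open>The dimension of the product of spheres, and the number of functions whose common zero
  is sought.\<close>

definition N :: nat where
  "N = k * (n - 1)"

text \<open>A coordinate \<open>a\<close> of a cell stands for the vertex \<open>{a}\<close> if it is even and for the open edge
  \<open>(a - 1, a + 1)\<close> if it is odd, so that a product of such pieces is represented by its barycenter.
  The product of \<open>k\<close> boundaries of cubes \<open>[-M, M]\<^sup>n\<close> consists of the cells in which each block
  has an extreme coordinate.\<close>

definition cells :: "(nat \<times> nat \<Rightarrow> int) set" where
  "cells = {v. (\<forall>i. i \<notin> I \<longrightarrow> v i = 0) \<and> (\<forall>i\<in>I. \<bar>v i\<bar> \<le> M) \<and>
     (\<forall>p\<in>{1..k}. \<exists>l<n. \<bar>v (p, l)\<bar> = M)}"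

text \<open>Geometrically, \<open>v\<close> is a face of codimension one of \<open>w\<close>: one
  vertex factor is replaced by an adjacent edge.\<close>

definition cov :: "(nat \<times> nat \<Rightarrow> int) \<Rightarrow> (nat \<times> nat \<Rightarrow> int) \<Rightarrow> bool" where
  "cov v w \<longleftrightarrow> v \<in> cells \<and> w \<in> cells \<and>
     (\<exists>i\<in>I. even (v i) \<and> (w = v(i := v i + 1) \<or> w = v(i := v i - 1)))"

text \<open>Each orbit of the sign group on flags has exactly one member whose initial vertex satisfies
  \<open>pos p\<close> for all \<open>p\<close>; summing over these members is summing over the quotient.\<close>

definition pos :: "nat \<Rightarrow> (nat \<times> nat \<Rightarrow> int) \<Rightarrow> bool" where
  "pos p v \<longleftrightarrow> (\<exists>l<n. 0 < v (p, l) \<and> (\<forall>l'\<in>{l<..<n}. v (p, l') = 0))"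

text \<open>For a cell \<open>v\<close>, this is the element of the sign group that carries
  \<open>v\<close> to the representative of its orbit.\<close>

definition neg_blocks :: "(nat \<times> nat \<Rightarrow> int) \<Rightarrow> nat set" where
  "neg_blocks v = {p \<in> {1..k}. \<not> pos p v}"

definition chain :: "(nat \<times> nat \<Rightarrow> int) list \<Rightarrow> bool" where
  "chain vs \<longleftrightarrow> length vs = Suc N \<and> set vs \<subseteq> cells \<and> (\<forall>i. even ((vs ! 0) i)) \<and>
     (\<forall>j<N. cov (vs ! j) (vs ! Suc j))"

definition flags :: "(nat \<times> nat \<Rightarrow> int) list set" where
  "flags = {vs. chain vs \<and> (\<forall>p\<in>{1..k}. pos p (vs ! 0))}"

lemma finite_flags: "finite flags"
proof -
  have "finite I"
    by (simp add: I_def)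
  then have "finite {v. \<forall>i. (i \<in> I \<longrightarrow> v i \<in> {-M..M}) \<and> (i \<notin> I \<longrightarrow> v i = 0)}"
    by (intro finite_set_of_finite_funs) auto
  then have "finite cells"
    by (rule rev_finite_subset) (auto simp: cells_def abs_le_iff minus_le_iff)
  then have "finite {vs. set vs \<subseteq> cells \<and> length vs = Suc N}"
    by (rule finite_lists_length_eq)
  then show ?thesis
    by (rule rev_finite_subset) (auto simp: flags_def chain_def)
qed

section \<open>Orbits of cells under the sign group\<close>

lemma pos_iff:
  assumes "l < n" "v (p, l) \<noteq> 0" "\<And>l'. l < l' \<Longrightarrow> l' < n \<Longrightarrow> v (p, l') = 0"
  shows "pos p v \<longleftrightarrow> 0 < v (p, l)"
proof
  assume "pos p v"
  then obtain l' where "l' < n" "0 < v (p, l')" "\<forall>l''\<in>{l'<..<n}. v (p, l'') = 0"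
    unfolding pos_def by blast
  then have "l' = l"
    using assms by (metis greaterThanLessThan_iff less_irrefl linorder_neqE_nat)
  then show "0 < v (p, l)"
    using \<open>0 < v (p, l')\<close> by simp
qed (use assms in \<open>auto simp: pos_def\<close>)

lemma flip_cells: "v \<in> cells \<Longrightarrow> flip S v \<in> cells"
  by (auto simp: cells_def flip_def)

text \<open>Each block of a cell has an extreme, hence nonzero, coordinate; the sign of its last
  nonzero coordinate decides \<open>pos\<close> and changes under the flip.\<close>

lemma pos_flip:
  assumes "v \<in> cells" "p \<in> {1..k}"
  shows "pos p (flip S v) \<longleftrightarrow> (p \<in> S) \<noteq> pos p v"
proof -
  obtain l0 where l0: "l0 < n" "\<bar>v (p, l0)\<bar> = M"
    using assms unfolding cells_def by blast
  have "v (p, l0) \<noteq> 0"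
    using l0 M by auto
  moreover define l where "l = (GREATEST l. l < n \<and> v (p, l) \<noteq> 0)"
  ultimately have l: "l < n \<and> v (p, l) \<noteq> 0"
    unfolding l_def using l0(1)
    by (intro GreatestI_nat[where P = "\<lambda>l. l < n \<and> v (p, l) \<noteq> 0" and b = n]) auto
  have zero: "v (p, l') = 0" if "l < l'" "l' < n" for l'
    using that Greatest_le_nat[of "\<lambda>l. l < n \<and> v (p, l) \<noteq> 0" l' n]
    unfolding l_def by fastforce
  have "pos p v \<longleftrightarrow> 0 < v (p, l)"
    by (rule pos_iff) (use l zero in blast)+
  moreover have "pos p (flip S v) \<longleftrightarrow> 0 < flip S v (p, l)"
    by (rule pos_iff) (use l zero in \<open>simp_all add: flip_def\<close>)
  ultimately show ?thesis
    using l by (auto simp: flip_def)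
qed

lemma neg_blocks_flip:
  assumes "v \<in> cells" "S \<subseteq> {1..k}"
  shows "neg_blocks (flip S v) = sym_diff (neg_blocks v) S"
  using assms by (auto simp: neg_blocks_def pos_flip)

text \<open>The sign group acts freely on cells, because a flip by \<open>S\<close> changes
  \<open>neg_blocks\<close> by exactly \<open>S\<close>.\<close>

lemma flip_eqD:
  assumes "v \<in> cells" "S \<subseteq> {1..k}" "flip S v = v"
  shows "S = {}"
proof -
  have "neg_blocks v = sym_diff (neg_blocks v) S"
    using neg_blocks_flip[OF assms(1,2)] assms(3) by simp
  then show ?thesis
    by blast
qed

section \<open>The face relation and its exchange properties\<close>

lemma cells_outside: "v \<in> cells \<Longrightarrow> i \<notin> I \<Longrightarrow> v i = 0"
  unfolding cells_def by blast

lemma cells_Le: "v \<in> cells \<Longrightarrow> \<bar>v i\<bar> \<le> M"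
  using M cells_outside[of v i] unfolding cells_def by (cases "i \<in> I") simp_all

lemma covI:
  assumes "v \<in> cells" "w \<in> cells" "even (v i)" "\<bar>w i - v i\<bar> = 1" "\<And>j. j \<noteq> i \<Longrightarrow> w j = v j"
  shows "cov v w"
proof -
  have "i \<in> I"
    using assms(4) cells_outside[OF assms(1), of i] cells_outside[OF assms(2), of i] by (cases "i \<in> I") auto
  moreover have "w i = v i + 1 \<or> w i = v i - 1"
    using assms(4) by auto
  then have "w = v(i := v i + 1) \<or> w = v(i := v i - 1)"
    using assms(5) by (metis fun_upd_idem_iff fun_upd_other fun_upd_same ext)
  ultimately show ?thesis
    using assms unfolding cov_def by blast
qed

lemma covE:
  assumes "cov v w"
  obtains i where "i \<in> I" "even (v i)" "odd (w i)" "\<bar>w i - v i\<bar> = 1" "\<And>j. j \<noteq> i \<Longrightarrow> w j = v j"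
proof -
  obtain i where "i \<in> I" "even (v i)" "w = v(i := v i + 1) \<or> w = v(i := v i - 1)"
    using assms unfolding cov_def by blast
  then show ?thesis
    by (intro that[of i]) auto
qed

lemma cov_diff:
  assumes "cov v w"
  shows "w i = v i \<or> (even (v i) \<and> odd (w i) \<and> \<bar>w i - v i\<bar> = 1)"
proof -
  obtain a where "even (v a)" "odd (w a)" "\<bar>w a - v a\<bar> = 1" "\<And>j. j \<noteq> a \<Longrightarrow> w j = v j"
    using assms by (rule covE) (rule that; blast)
  then show ?thesis
    by (cases "i = a") auto
qed

lemma cov_flip:
  assumes "cov v w"
  shows "cov (flip S v) (flip S w)"
proof -
  obtain i where i: "i \<in> I" "even (v i)" "odd (w i)" "\<bar>w i - v i\<bar> = 1" "\<And>j. j \<noteq> i \<Longrightarrow> w j = v j"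
    using assms by (rule covE) (rule that; blast)
  have "v \<in> cells" "w \<in> cells"
    using assms by (auto simp: cov_def)
  then show ?thesis
    using i by (intro covI[of _ _ i]) (auto simp: flip_cells, auto simp: flip_def)
qed

lemma chain_flip: "chain vs \<Longrightarrow> chain (map (flip S) vs)"
  unfolding chain_def using flip_cells cov_flip
  by (auto simp: nth_map flip_def)

text \<open>Extreme coordinates are even because \<open>M\<close> is, so keeping the even
  coordinates of \<open>w\<close> keeps an extreme one in each block.\<close>

lemma cellsI_even:
  assumes "w \<in> cells" "\<And>i. even (w i) \<Longrightarrow> v i = w i" "\<And>i. i \<in> I \<Longrightarrow> \<bar>v i\<bar> \<le> M"
    "\<And>i. i \<notin> I \<Longrightarrow> v i = 0"
  shows "v \<in> cells"
proof -
  have "\<exists>l<n. \<bar>v (p, l)\<bar> = M" if p: "p \<in> {1..k}" for p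
  proof -
    obtain l where l: "l < n" "\<bar>w (p, l)\<bar> = M"
      using assms(1) p unfolding cells_def by blast
    then have "even (w (p, l))"
      using M by (metis dvd_abs_iff)
    then show ?thesis
      using assms(2)[of "(p, l)"] l by auto
  qed
  then show ?thesis
    using assms by (auto simp: cells_def)
qed

text \<open>Together with \<open>cov_bottom\<close> and \<open>cov_top\<close>, this makes the sum of all flags a cycle modulo 2.\<close>

lemma cov_middle:
  assumes "cov u v" "cov v w"
  defines "v' \<equiv> \<lambda>i. u i + w i - v i"
  shows "cov u v'" "cov v' w" "v' \<noteq> v"
proof -
  obtain a where a: "a \<in> I" "even (u a)" "odd (v a)" "\<bar>v a - u a\<bar> = 1" "\<And>j. j \<noteq> a \<Longrightarrow> v j = u j"
    using assms(1) by (rule covE) (rule that; blast)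
  obtain b where b: "b \<in> I" "even (v b)" "odd (w b)" "\<bar>w b - v b\<bar> = 1" "\<And>j. j \<noteq> b \<Longrightarrow> w j = v j"
    using assms(2) by (rule covE) (rule that; blast)
  have ab: "a \<noteq> b"
    using a b by auto
  have uw: "u \<in> cells" "w \<in> cells"
    using assms by (auto simp: cov_def)
  \<comment> \<open>Two coordinates change between \<open>u\<close> and \<open>w\<close>; the path
    through \<open>v\<close> changes \<open>a\<close> first, the one through \<open>v'\<close>
    changes \<open>b\<close> first.\<close>
  have v': "v' j = (if j = b then w b else u j)" for j
    using a b ab by (auto simp: v'_def)
  have "v' \<in> cells"
  proof (rule cellsI_even[OF uw(2)])
    show "v' j = w j" if "even (w j)" for j
      using that a b ab by (cases "j = a") (auto simp: v')
    show "\<bar>v' j\<bar> \<le> M" for j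
      using cells_Le uw by (simp add: v')
    show "v' j = 0" if "j \<notin> I" for j
      using that uw b cells_outside by (auto simp: v')
  qed
  then show "cov u v'"
    using a b ab uw by (auto intro!: covI[of u v' b] simp: v')
  have "w a = v a"
    using b(5)[OF ab] .
  then show "cov v' w"
    using \<open>v' \<in> cells\<close> a b(5) ab uw by (intro covI[of v' w a]) (simp_all add: v' abs_minus_commute)
  show "v' \<noteq> v"
    using a ab v' by metis
qed

text \<open>The cell \<open>w\<close> is an edge, and reflecting its end \<open>v\<close> in the
  barycenter gives the other end.\<close>

lemma cov_bottom:
  assumes "cov v w" "\<And>i. even (v i)"
  defines "v' \<equiv> \<lambda>i. 2 * w i - v i"
  shows "cov v' w" "\<And>i. even (v' i)" "v' \<noteq> v"
proof -
  obtain a where a: "a \<in> I" "even (v a)" "odd (w a)" "\<bar>w a - v a\<bar> = 1" "\<And>j. j \<noteq> a \<Longrightarrow> w j = v j"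
    using assms(1) by (rule covE) (rule that; blast)
  have vw: "v \<in> cells" "w \<in> cells"
    using assms by (auto simp: cov_def)
  show ev: "even (v' i)" for i
    using assms by (simp add: v'_def)
  \<comment> \<open>An odd coordinate is not extreme, so the far end of the edge stays between
    \<open>-M\<close> and \<open>M\<close>.\<close>
  have "\<bar>w a\<bar> \<noteq> M"
    using a(3) M(1) by (metis dvd_abs_iff)
  then have wa: "\<bar>w a\<bar> \<le> M - 1"
    using cells_Le[OF vw(2), of a] by simp
  have v': "v' j = (if j = a then 2 * w a - v a else v j)" for j
    using a by (auto simp: v'_def)
  have "v' \<in> cells"
  proof (rule cellsI_even[OF vw(2)])
    show "v' j = w j" if "even (w j)" for j
      using that a by (cases "j = a") (auto simp: v')
    show "\<bar>v' j\<bar> \<le> M" for j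
      using cells_Le[OF vw(1)] wa a(4) by (auto simp: v')
    show "v' j = 0" if "j \<notin> I" for j
      using that vw a cells_outside by (auto simp: v')
  qed
  then show "cov v' w"
    using a vw ev by (auto intro!: covI[of v' w a] simp: v')
  show "v' \<noteq> v"
  proof
    assume "v' = v"
    then have "v a = 2 * w a - v a"
      using v'[of a] by simp
    then show False
      using a(4) by simp
  qed
qed

section \<open>Cells of full dimension\<close>

lemma chain_nth_cells: "chain F \<Longrightarrow> t \<le> N \<Longrightarrow> F ! t \<in> cells"
  unfolding chain_def by (metis less_Suc_eq_le nth_mem subsetD)

text \<open>Every step turns one even coordinate odd, so odd coordinates count the
  dimension.\<close>

lemma chain_card_odd:
  assumes "chain F" "t \<le> N"
  shows "card {i \<in> I. odd ((F ! t) i)} = t"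
  using assms(2)
proof (induction t)
  case 0
  have "even ((F ! 0) i)" for i
    using assms(1) unfolding chain_def by blast
  then show ?case
    by simp
next
  case (Suc t)
  then have "cov (F ! t) (F ! Suc t)"
    using assms(1) by (simp add: chain_def)
  then obtain a where a: "a \<in> I" "even ((F ! t) a)" "odd ((F ! Suc t) a)"
      "\<And>j. j \<noteq> a \<Longrightarrow> (F ! Suc t) j = (F ! t) j"
    by (rule covE) (rule that; blast)
  have "odd ((F ! Suc t) i) \<longleftrightarrow> i = a \<or> odd ((F ! t) i)" for i
    using a(2,3) a(4)[of i] by (cases "i = a") simp_all
  then have "{i \<in> I. odd ((F ! Suc t) i)} = insert a {i \<in> I. odd ((F ! t) i)}"
    using a(1) by blast
  moreover have "finite I"
    by (simp add: I_def)
  ultimately show ?case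
    using Suc a(2) by simp
qed

text \<open>A top cell has \<open>k * n - k\<close> odd coordinates and so \<open>k\<close> even
  ones; each block contains an extreme one, which is even, and hence has no other.\<close>

lemma chain_top_even:
  assumes "chain F" "p \<in> {1..k}"
  shows "\<exists>e<n. \<bar>(F ! N) (p, e)\<bar> = M \<and> (\<forall>l<n. even ((F ! N) (p, l)) \<longrightarrow> l = e)"
proof -
  define w where "w = F ! N"
  define E where "E q = {l. l < n \<and> even (w (q, l))}" for q
  have w: "w \<in> cells"
    using assms(1) by (simp add: w_def chain_nth_cells)
  have evenM: "even x" if "\<bar>x\<bar> = M" for x
    using that M(1) by (metis dvd_abs_iff)
  have fin: "finite (E q)" for q
    by (simp add: E_def)
  have ge: "1 \<le> card (E q)" if q: "q \<in> {1..k}" for q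
  proof -
    obtain l where "l < n" "\<bar>w (q, l)\<bar> = M"
      using w q unfolding cells_def by blast
    then have "l \<in> E q"
      using evenM by (simp add: E_def)
    then have "card (E q) \<noteq> 0"
      using fin[of q] by auto
    then show ?thesis
      by simp
  qed
  have "card ({i \<in> I. odd (w i)} \<union> Sigma {1..k} E) = card {i \<in> I. odd (w i)} + card (Sigma {1..k} E)"
    using fin by (intro card_Un_disjoint) (auto simp: I_def E_def)
  moreover have "{i \<in> I. odd (w i)} \<union> Sigma {1..k} E = I"
    by (auto simp: I_def E_def)
  ultimately have "k * n = N + (\<Sum>q\<in>{1..k}. card (E q))"
    using chain_card_odd[OF assms(1), of N] fin by (simp add: I_def w_def)
  moreover have "k * n = N + k"
    using n unfolding N_def by (cases n) auto
  ultimately have sum: "(\<Sum>q\<in>{1..k}. card (E q)) = (\<Sum>q\<in>{1..k}. 1)"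
    by simp
  have "card (E p) = 1"
    using sum_mono_inv[OF sum[symmetric] ge assms(2)] by simp
  then obtain e where e: "E p = {e}"
    by (auto simp: card_1_singleton_iff)
  obtain l where l: "l < n" "\<bar>w (p, l)\<bar> = M"
    using w assms(2) unfolding cells_def by blast
  then have "l \<in> E p"
    using evenM by (simp add: E_def)
  then have "l = e"
    using e by simp
  moreover have "l' = e" if "l' < n" "even (w (p, l'))" for l'
    using that e by (auto simp: E_def)
  ultimately show ?thesis
    using l unfolding w_def by blast
qed

text \<open>The product of cube boundaries is a closed pseudomanifold: a cell of codimension one
  lies in exactly two top cells. In the block \<open>q\<close> of the changed coordinate
  \<open>a\<close>, the smaller cell has two even coordinates, \<open>a\<close> and the extreme
  \<open>(q, e)\<close>.\<close>

lemma cov_top: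
  assumes "chain F" "N = Suc m"
  shows "\<exists>!w'. w' \<noteq> F ! N \<and> cov (F ! m) w'"
proof -
  define v w where "v = F ! m" and "w = F ! N"
  have vw: "cov v w"
    using assms by (simp add: v_def w_def chain_def)
  then have cells: "v \<in> cells" "w \<in> cells"
    by (auto simp: cov_def)
  obtain a where a: "a \<in> I" "even (v a)" "odd (w a)" "\<bar>w a - v a\<bar> = 1" "\<And>j. j \<noteq> a \<Longrightarrow> w j = v j"
    using vw by (rule covE) (rule that; blast)
  obtain q l where ql: "a = (q, l)" "q \<in> {1..k}" "l < n"
    using a(1) by (auto simp: I_def)
  obtain e where e: "e < n" "\<bar>w (q, e)\<bar> = M" "\<forall>l<n. even (w (q, l)) \<longrightarrow> l = e"
    using chain_top_even[OF assms(1) ql(2)] unfolding w_def by blast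
  let ?b = "(q, e)"
  have evenM: "even x" if "\<bar>x\<bar> = M" for x
    using that M(1) by (metis dvd_abs_iff)
  have ab: "?b \<noteq> a"
    using evenM[OF e(2)] a(3) by auto
  then have vb: "\<bar>v ?b\<bar> = M" "even (v ?b)"
    using a(5) e(2) evenM by auto
  \<comment> \<open>In any other block the only even coordinate is the extreme one, and changing it
    would leave the block without an extreme coordinate.\<close>
  have changed: "b = a \<or> b = ?b"
    if u: "cov v u" "b \<in> I" "even (v b)" "odd (u b)" "\<And>j. j \<noteq> b \<Longrightarrow> u j = v j" for u b
  proof (rule ccontr)
    assume b: "\<not> (b = a \<or> b = ?b)"
    obtain p j where pj: "b = (p, j)" "p \<in> {1..k}" "j < n"
      using u(2) by (auto simp: I_def)
    have wb: "even (w (p, j))"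
      using b a(5) u(3) pj by metis
    obtain e' where e': "e' < n" "\<forall>l<n. even (w (p, l)) \<longrightarrow> l = e'"
      using chain_top_even[OF assms(1) pj(2)] unfolding w_def by blast
    have "p \<noteq> q"
      using b e(3) wb pj ql by auto
    obtain j' where j': "j' < n" "\<bar>u (p, j')\<bar> = M"
      using u(1) pj(2) unfolding cov_def cells_def by blast
    then have "j' \<noteq> j"
      using evenM[OF j'(2)] u(4) pj by auto
    then have "u (p, j') = v (p, j')"
      using u(5) pj by simp
    also have "\<dots> = w (p, j')"
      using a(5) ql \<open>p \<noteq> q\<close> by simp
    finally have "even (w (p, j'))"
      using evenM[OF j'(2)] by simp
    then show False
      using e'(2) wb pj j' \<open>j' \<noteq> j\<close> by metis
  qed
  have "\<exists>!w'. w' \<noteq> w \<and> cov v w'"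
  proof (cases "\<bar>v a\<bar> = M")
    \<comment> \<open>Both top cells lie in the same facet of the cube, on either side of
      \<open>v\<close>.\<close>
    case False
    then have va: "\<bar>v a\<bar> < M"
      using cells_Le[OF cells(1), of a] by simp
    let ?w = "v(a := 2 * v a - w a)"
    have "?w \<in> cells"
      by (rule cellsI_even[OF cells(2)]) (use a va cells_Le[OF cells(1)] cells_outside[OF cells(1)] in auto)
    then have "cov v ?w"
      using cells a by (intro covI[of _ _ a]) auto
    moreover have "?w \<noteq> w"
    proof
      assume "?w = w"
      then have "2 * v a - w a = w a"
        by (metis fun_upd_same)
      then show False
        using a(4) by simp
    qed
    moreover have "u = ?w" if u: "u \<noteq> w" "cov v u" for u
    proof -
      obtain b where b: "b \<in> I" "even (v b)" "odd (u b)" "\<bar>u b - v b\<bar> = 1" "\<And>j. j \<noteq> b \<Longrightarrow> u j = v j"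
        using u(2) by (rule covE) (rule that; blast)
      have "b = a"
      proof (rule ccontr)
        assume "b \<noteq> a"
        then have "b = ?b"
          using changed[OF u(2) b(1,2,3,5)] by blast
        obtain j' where j': "j' < n" "\<bar>u (q, j')\<bar> = M"
          using u(2) ql(2) unfolding cov_def cells_def by blast
        have "j' \<noteq> e"
          using evenM[OF j'(2)] b(3) \<open>b = ?b\<close> by auto
        then have "\<bar>v (q, j')\<bar> = M"
          using j' b(5) \<open>b = ?b\<close> by simp
        then have "(q, j') \<noteq> a"
          using va by auto
        then have "w (q, j') = v (q, j')"
          using a(5) by simp
        then show False
          using e(3) j'(1) \<open>j' \<noteq> e\<close> evenM[OF \<open>\<bar>v (q, j')\<bar> = M\<close>] by simp
      qed
      have "u a \<noteq> w a"
      proof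
        assume "u a = w a"
        then have "u j = w j" for j
          using a(5)[of j] b(5)[of j] \<open>b = a\<close> by (cases "j = a") auto
        then show False
          using u(1) by blast
      qed
      then have "u a = 2 * v a - w a"
        using a(4) b(4) \<open>b = a\<close> by auto
      then show ?thesis
        using b(5) \<open>b = a\<close> by (intro ext) auto
    qed
    ultimately show ?thesis
      by blast
  next
    \<comment> \<open>Here \<open>v\<close> lies where two facets meet: \<open>w\<close> moves
      \<open>a\<close> inward, and the other top cell moves \<open>?b\<close> inward.\<close>
    case True
    let ?w = "v(?b := v ?b - sgn (v ?b))"
    have vb0: "v ?b \<noteq> 0"
      using vb M by auto
    then have wb: "\<bar>?w ?b - v ?b\<bar> = 1" "\<bar>?w ?b\<bar> \<le> M"
      using vb by (auto simp: abs_if sgn_if split: if_splits)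
    have "\<exists>j<n. \<bar>?w (p, j)\<bar> = M" if p: "p \<in> {1..k}" for p
    proof (cases "p = q")
      case True
      then show ?thesis
        using \<open>\<bar>v a\<bar> = M\<close> ql ab by (intro exI[of _ l]) auto
    next
      case False
      then show ?thesis
        using cells(1) p by (auto simp: cells_def)
    qed
    moreover have "\<bar>?w i\<bar> \<le> M" if "i \<in> I" for i
      using wb cells_Le[OF cells(1)] by (cases "i = ?b") auto
    moreover have "?w i = 0" if "i \<notin> I" for i
      using that cells_outside[OF cells(1)] e(1) ql by (auto simp: I_def)
    ultimately have "?w \<in> cells"
      unfolding cells_def by blast
    then have "cov v ?w"
      using cells wb vb by (intro covI[of _ _ ?b]) auto
    moreover have "?w \<noteq> w"
    proof
      assume "?w = w"
      then have "?w ?b = v ?b"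
        using a(5) ab by metis
      then show False
        using wb by simp
    qed
    moreover have "u = ?w" if u: "u \<noteq> w" "cov v u" for u
    proof -
      obtain b where b: "b \<in> I" "even (v b)" "odd (u b)" "\<bar>u b - v b\<bar> = 1" "\<And>j. j \<noteq> b \<Longrightarrow> u j = v j"
        using u(2) by (rule covE) (rule that; blast)
      have uM: "\<bar>u i\<bar> \<le> M" for i
        using u(2) cells_Le by (auto simp: cov_def)
      have "b \<noteq> a"
      proof
        assume "b = a"
        have "u a = w a"
          using True uM[of a] cells_Le[OF cells(2), of a] a(4) b(4) \<open>b = a\<close>
          by (auto simp: abs_if split: if_splits)
        then have "u j = w j" for j
          using a(5)[of j] b(5)[of j] \<open>b = a\<close> by (cases "j = a") auto
        then show False
          using u(1) by blast
      qed
      then have "b = ?b"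
        using changed[OF u(2) b(1,2,3,5)] by blast
      then have "u ?b = v ?b - sgn (v ?b)"
        using vb uM[of ?b] b(4) vb0 by (auto simp: abs_if sgn_if split: if_splits)
      then show ?thesis
        using b(5) \<open>b = ?b\<close> by (intro ext) auto
    qed
    ultimately show ?thesis
      by blast
  qed
  then show ?thesis
    by (simp add: v_def w_def)
qed

section \<open>The sum of all flags as a cycle modulo 2 on the quotient\<close>

lemma flags_update:
  assumes "F \<in> flags" "0 < j" "j \<le> N" "cov (F ! (j - 1)) x" "j < N \<Longrightarrow> cov x (F ! Suc j)"
  shows "F[j := x] \<in> flags"
proof -
  have F: "length F = Suc N" "set F \<subseteq> cells" "\<forall>i. even ((F ! 0) i)" "\<forall>t<N. cov (F ! t) (F ! Suc t)"
    using assms(1) by (auto simp: flags_def chain_def)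
  have "cov (F[j := x] ! t) (F[j := x] ! Suc t)" if "t < N" for t
    using that assms F by (cases "t = j"; cases "Suc t = j") auto
  moreover have "x \<in> cells"
    using assms(4) by (simp add: cov_def)
  then have "set (F[j := x]) \<subseteq> cells"
    using F(2) set_update_subset_insert by fast
  ultimately show ?thesis
    using assms(1,2) F by (simp add: flags_def chain_def)
qed

definition invariant :: "(nat \<times> nat \<Rightarrow> int) cochain \<Rightarrow> bool" where
  "invariant c \<longleftrightarrow> (\<forall>S vs. S \<subseteq> {1..k} \<longrightarrow> set vs \<subseteq> cells \<longrightarrow> c (map (flip S) vs) = c vs)"

text \<open>Face \<open>j\<close> deletes the \<open>j\<close>-th cell, and exchanging that cell for
  the other one between its neighbours pairs the flags.\<close>

lemma sum_face_middle:
  assumes "0 < j" "j < N"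
  shows "(\<Sum>F\<in>flags. c (face j F) :: bit) = 0"
proof -
  define x where "x F = (\<lambda>i. (F ! (j - 1)) i + (F ! Suc j) i - (F ! j) i)" for F :: "(nat \<times> nat \<Rightarrow> int) list"
  show ?thesis
  proof (rule sum_involution_bit[where g = "\<lambda>F. F[j := x F]"])
    fix F assume F: "F \<in> flags"
    then have len: "length F = Suc N"
      by (simp add: flags_def chain_def)
    have "cov (F ! (j - 1)) (F ! j)" "cov (F ! j) (F ! Suc j)"
      using F assms by (auto simp: flags_def chain_def dest!: spec[of _ "j - 1"])
    note x = cov_middle[OF this, folded x_def]
    show "F[j := x F] \<in> flags"
      using F assms x by (intro flags_update) auto
    show "F[j := x F] \<noteq> F"
      using x(3) len assms by (metis less_SucI nth_list_update_eq)
    have "x (F[j := x F]) = F ! j"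
      using len assms by (auto simp: x_def fun_eq_iff)
    then show "(F[j := x F])[j := x (F[j := x F])] = F"
      by simp
  qed (auto simp: finite_flags)
qed

text \<open>Flags are paired by exchanging the top cell, which has a single alternative by
  \<open>cov_top\<close>.\<close>

lemma sum_face_top:
  assumes "N = Suc m"
  shows "(\<Sum>F\<in>flags. c (face N F) :: bit) = 0"
proof -
  define x where "x F = (THE w'. w' \<noteq> F ! N \<and> cov (F ! m) w')" for F :: "(nat \<times> nat \<Rightarrow> int) list"
  have x: "x F \<noteq> F ! N \<and> cov (F ! m) (x F)" if "F \<in> flags" for F
    using that theI'[OF cov_top[OF _ assms]] by (simp add: flags_def x_def)
  have x_eq: "x F = u" if "F \<in> flags" "u \<noteq> F ! N \<and> cov (F ! m) u" for F u
    unfolding x_def by (rule the1_equality[OF cov_top[OF _ assms]]) (use that in \<open>auto simp: flags_def\<close>)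
  show ?thesis
  proof (rule sum_involution_bit[where g = "\<lambda>F. F[N := x F]"])
    fix F assume F: "F \<in> flags"
    then have len: "length F = Suc N"
      by (simp add: flags_def chain_def)
    show upd: "F[N := x F] \<in> flags"
      using F assms x[OF F] by (intro flags_update) auto
    show "F[N := x F] \<noteq> F"
      using x[OF F] len by (metis lessI nth_list_update_eq)
    have "cov (F ! m) (F ! N)"
      using F assms by (auto simp: flags_def chain_def)
    then have "x (F[N := x F]) = F ! N"
      using x[OF F] len assms by (intro x_eq[OF upd]) auto
    then show "(F[N := x F])[N := x (F[N := x F])] = F"
      by simp
  qed (auto simp: finite_flags)
qed

text \<open>Exchanging the initial vertex for the other end of the first edge may leave the chosen
  representatives, so the whole chain is flipped back; this is where invariance of \<open>c\<close>
  enters.\<close>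

lemma sum_face_bottom:
  assumes "0 < N" "invariant c"
  shows "(\<Sum>F\<in>flags. c (face 0 F) :: bit) = 0"
proof -
  define x where "x F = (\<lambda>i. 2 * (F ! 1) i - (F ! 0) i)" for F :: "(nat \<times> nat \<Rightarrow> int) list"
  define g where "g F = map (flip (neg_blocks (x F))) (F[0 := x F])" for F
  show ?thesis
  proof (rule sum_involution_bit[where g = g])
    fix F assume F: "F \<in> flags"
    let ?S = "neg_blocks (x F)"
    have S: "?S \<subseteq> {1..k}"
      by (auto simp: neg_blocks_def)
    have len: "length F = Suc N" and cells: "set F \<subseteq> cells"
      using F by (auto simp: flags_def chain_def)
    have "cov (F ! 0) (F ! 1)" "\<And>i. even ((F ! 0) i)"
      using F assms by (auto simp: flags_def chain_def)
    note x = cov_bottom[OF this, folded x_def]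
    then have "x F \<in> cells"
      by (simp add: cov_def)
    have "cov (F[0 := x F] ! t) (F[0 := x F] ! Suc t)" if "t < N" for t
      using that F x assms len by (cases t) (auto simp: flags_def chain_def)
    moreover have "set (F[0 := x F]) \<subseteq> cells"
      using cells \<open>x F \<in> cells\<close> set_update_subset_insert by fast
    ultimately have "chain (F[0 := x F])"
      using len x(2) by (simp add: chain_def x_def del: split_paired_All)
    moreover have "pos p (flip ?S (x F))" if "p \<in> {1..k}" for p
      using that pos_flip[OF \<open>x F \<in> cells\<close> that] by (auto simp: neg_blocks_def)
    ultimately show "g F \<in> flags"
      using chain_flip[of "F[0 := x F]"] len by (simp add: g_def flags_def)
    have neg0: "neg_blocks (F ! 0) = {}"
      using F by (auto simp: flags_def neg_blocks_def)
    have "x (g F) = flip ?S (F ! 0)"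
      using len assms by (auto simp: x_def g_def flip_def fun_eq_iff nth_list_update)
    moreover have "neg_blocks (flip ?S (F ! 0)) = ?S"
      using S len cells neg0 by (subst neg_blocks_flip) auto
    moreover have "(g F)[0 := flip ?S (F ! 0)] = map (flip ?S) F"
      using len by (auto simp: g_def list_eq_iff_nth_eq nth_list_update)
    ultimately have "g (g F) = map (flip ?S) (map (flip ?S) F)"
      unfolding g_def[of "g F"] by simp
    then show "g (g F) = F"
      by (simp add: map_idI)
    show "g F \<noteq> F"
    proof
      \<comment> \<open>A fixed flag would make the flip trivial, by freeness on the second cell,
        and then the two ends of the first edge would agree.\<close>
      assume eq: "g F = F"
      then have "g F ! 1 = F ! 1"
        by simp
      then have "flip ?S (F ! 1) = F ! 1"
        using len assms by (simp add: g_def)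
      then have "?S = {}"
        using S len cells assms by (intro flip_eqD[of "F ! 1"]) auto
      then have "g F ! 0 = x F"
        using len by (simp add: g_def)
      then show False
        using x(3) eq by simp
    qed
    have "set (face 0 F) \<subseteq> cells"
      using set_face cells by fast
    then show "c (face 0 (g F)) = c (face 0 F)"
      using assms(2) S by (simp add: g_def face_map invariant_def)
  qed (auto simp: finite_flags)
qed

lemma sum_coboundary:
  assumes "0 < N" "invariant c"
  shows "(\<Sum>F\<in>flags. coboundary c F) = 0"
proof -
  have "(\<Sum>F\<in>flags. coboundary c F) = (\<Sum>F\<in>flags. \<Sum>j\<le>N. c (face j F))"
    by (intro sum.cong refl)
       (auto simp: coboundary_eq_sum face_def flags_def chain_def lessThan_Suc_atMost simp del: sum.lessThan_Suc)
  also have "\<dots> = (\<Sum>j\<le>N. \<Sum>F\<in>flags. c (face j F))"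
    by (rule sum.swap)
  also have "\<dots> = 0"
  proof (rule sum.neutral, safe)
    fix j assume "j \<le> N"
    then consider "j = 0" | "0 < j" "j < N" | m where "j = N" "N = Suc m"
      using assms(1) by (metis gr0_conv_Suc le_neq_implies_less neq0_conv)
    then show "(\<Sum>F\<in>flags. c (face j F)) = 0"
      by cases (use assms sum_face_bottom sum_face_middle sum_face_top in auto)
  qed
  finally show ?thesis .
qed

end

section \<open>The crossing number of equivariant sign functions\<close>

lemma cups_add: "cups ss (\<lambda>vs. c vs + d vs) vs = cups ss c vs + cups ss d vs"
proof (induction ss arbitrary: vs)
  case (Cons s ss)
  then show ?case
    by (cases "(s, cups ss c, vs)" rule: cup1.cases) (auto simp: distrib_left distrib_right add_ac)
qed auto

lemma cup1_add: "cup1 s c vs + cup1 t c vs = cup1 (\<lambda>v. s v + t v) c vs"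
  by (cases "(s, c, vs)" rule: cup1.cases) (auto simp: distrib_left distrib_right add_ac)

lemma cups_one_iff:
  assumes "length vs = Suc (length ss)"
  shows "cups ss (\<lambda>_. 1) vs = 1 \<longleftrightarrow> (\<forall>j<length ss. (ss ! j) (vs ! j) \<noteq> (ss ! j) (vs ! Suc j))"
  using assms
proof (induction ss arbitrary: vs)
  case (Cons s ss)
  then obtain v w us where vs: "vs = v # w # us"
    by (cases vs; cases "tl vs") auto
  have "cups (s # ss) (\<lambda>_. 1) vs = 1 \<longleftrightarrow> s v \<noteq> s w \<and> cups ss (\<lambda>_. 1) (w # us) = 1"
    by (cases "s v"; cases "s w") (auto simp: vs)
  also have "\<dots> \<longleftrightarrow> s v \<noteq> s w \<and> (\<forall>j<length ss. (ss ! j) ((w # us) ! j) \<noteq> (ss ! j) ((w # us) ! Suc j))"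
    using Cons by (simp add: vs)
  also have "\<dots> \<longleftrightarrow> (\<forall>j<Suc (length ss). ((s # ss) ! j) (vs ! j) \<noteq> ((s # ss) ! j) (vs ! Suc j))"
    by (auto simp: vs less_Suc_eq_0_disj)
  finally show ?case
    by simp
qed auto

context cube_grid
begin

section \<open>Exchange of sign functions with the same character\<close>

text \<open>\<open>T\<close> is the support of the character by which \<open>s\<close>
  transforms.\<close>

definition equivariant :: "nat set \<Rightarrow> ((nat \<times> nat \<Rightarrow> int) \<Rightarrow> bit) \<Rightarrow> bool" where
  "equivariant T s \<longleftrightarrow>
     (\<forall>v\<in>cells. \<forall>S. S \<subseteq> {1..k} \<longrightarrow> s (flip S v) = s v + (\<Sum>p\<in>T. of_bool (p \<in> S)))"

lemma invariantD:
  "invariant c \<Longrightarrow> S \<subseteq> {1..k} \<Longrightarrow> set vs \<subseteq> cells \<Longrightarrow> c (map (flip S) vs) = c vs"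
  unfolding invariant_def by blast

text \<open>The character adds the same bit at both ends of an edge and cancels in
  \<open>\<delta>s\<close>.\<close>

lemma invariant_cup1:
  assumes "equivariant T s" "invariant c"
  shows "invariant (cup1 s c)"
  unfolding invariant_def
proof (intro allI impI)
  fix S vs assume S: "S \<subseteq> {1..k}" "set vs \<subseteq> cells"
  show "cup1 s c (map (flip S) vs) = cup1 s c vs"
  proof (cases "(s, c, vs)" rule: cup1.cases)
    case (1 a d v w us)
    have "s (flip S v) + s (flip S w) = s v + s w"
      using assms(1) S 1 by (simp add: equivariant_def distrib_left distrib_right add_ac)
    moreover have "set (w # us) \<subseteq> cells"
      using S(2) 1 by simp
    then have c: "c (map (flip S) (w # us)) = c (w # us)"
      by (rule invariantD[OF assms(2) S(1)])
    ultimately show ?thesis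
      using 1 c by simp
  qed auto
qed

lemma invariant_cups:
  assumes "\<And>s. s \<in> set ss \<Longrightarrow> \<exists>T. equivariant T s" "invariant c"
  shows "invariant (cups ss c)"
  using assms(1)
proof (induction ss)
  case (Cons s ss)
  then obtain T where "equivariant T s"
    by auto
  then show ?case
    using Cons by (auto intro: invariant_cup1)
qed (use assms(2) in simp)

lemma invariant_cup0:
  assumes "\<And>v S. v \<in> cells \<Longrightarrow> S \<subseteq> {1..k} \<Longrightarrow> h (flip S v) = h v" "invariant c"
  shows "invariant (cup0 h c)"
  unfolding invariant_def
proof (intro allI impI)
  fix S vs assume S: "S \<subseteq> {1..k}" "set vs \<subseteq> cells"
  show "cup0 h c (map (flip S) vs) = cup0 h c vs"
  proof (cases vs)
    case (Cons v us)
    then have "c (map (flip S) (v # us)) = c (v # us)"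
      using S by (intro invariantD[OF assms(2)]) simp_all
    then show ?thesis
      using Cons assms(1) S by simp
  qed simp
qed

text \<open>With equal characters the sum of \<open>s\<close> and \<open>t\<close> is invariant, so
  \<open>\<delta>s\<close> and \<open>\<delta>t\<close> differ by a coboundary on the quotient;
  multiplied by the other cocycles, the difference stays a coboundary and sums to 0 over the
  flags.\<close>

lemma sum_cups_exchange_one:
  assumes "equivariant T s" "equivariant T t"
    and "\<And>s. s \<in> set ss \<union> set ts \<Longrightarrow> \<exists>T. equivariant T s" "Suc (length ss + length ts) = N"
  shows "(\<Sum>F\<in>flags. cups (ss @ s # ts) (\<lambda>_. 1) F) = (\<Sum>F\<in>flags. cups (ss @ t # ts) (\<lambda>_. 1) F)"
proof -
  let ?h = "\<lambda>v. s v + t v" and ?c = "cups ts (\<lambda>_. 1 :: bit)"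
  have one: "invariant (\<lambda>_. 1)"
    by (simp add: invariant_def)
  have "?h (flip S v) = ?h v" if "v \<in> cells" "S \<subseteq> {1..k}" for v S
    using that assms(1,2) by (simp add: equivariant_def distrib_left distrib_right add_ac)
  then have inv: "invariant (cups ss (cup0 ?h ?c))"
    using assms(3) by (intro invariant_cups invariant_cup0 one) auto
  have "cups (ss @ s # ts) (\<lambda>_. 1) F + cups (ss @ t # ts) (\<lambda>_. 1) F = coboundary (cups ss (cup0 ?h ?c)) F"
    if "F \<in> flags" for F
  proof -
    have len: "length F = length ss + (length ts + 2)"
      using that assms(4) by (simp add: flags_def chain_def)
    have "cups (ss @ s # ts) (\<lambda>_. 1) F + cups (ss @ t # ts) (\<lambda>_. 1) F = cups ss (cup1 ?h ?c) F"
      by (simp add: cups_append cup1_add flip: cups_add)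
    also have "\<dots> = cups ss (coboundary (cup0 ?h ?c)) F"
    proof (rule cups_cong[OF len])
      fix ws :: "(nat \<times> nat \<Rightarrow> int) list" assume "length ws = length ts + 2"
      then show "cup1 ?h ?c ws = coboundary (cup0 ?h ?c) ws"
        using coboundary_cups_one[of ws ts] by (subst coboundary_cup0) auto
    qed simp
    also have "\<dots> = coboundary (cups ss (cup0 ?h ?c)) F"
      using len by (intro coboundary_cups[symmetric]) simp
    finally show ?thesis .
  qed
  then have "(\<Sum>F\<in>flags. cups (ss @ s # ts) (\<lambda>_. 1) F) + (\<Sum>F\<in>flags. cups (ss @ t # ts) (\<lambda>_. 1) F)
      = (\<Sum>F\<in>flags. coboundary (cups ss (cup0 ?h ?c)) F)"
    by (simp flip: sum.distrib)
  also have "\<dots> = 0"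
    using assms(4) by (intro sum_coboundary inv) simp
  finally show ?thesis
    by (simp only: bit_add_eq_0_iff)
qed

lemma sum_cups_exchange:
  assumes "\<And>i. i \<in> set (xs @ ys) \<Longrightarrow> equivariant (T i) (s i)"
    and "\<And>i. i \<in> set (xs @ ys) \<Longrightarrow> equivariant (T i) (t i)" "length (xs @ ys) = N"
  shows "(\<Sum>F\<in>flags. cups (map s xs @ map t ys) (\<lambda>_. 1) F) = (\<Sum>F\<in>flags. cups (map s (xs @ ys)) (\<lambda>_. 1) F)"
  using assms
proof (induction ys arbitrary: xs)
  case (Cons y ys)
  have "(\<Sum>F\<in>flags. cups (map s xs @ t y # map t ys) (\<lambda>_. 1) F) =
      (\<Sum>F\<in>flags. cups (map s xs @ s y # map t ys) (\<lambda>_. 1) F)"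
  proof (rule sum_cups_exchange_one)
    show "equivariant (T y) (t y)" "equivariant (T y) (s y)"
      using Cons.prems by auto
    show "\<exists>T. equivariant T u" if "u \<in> set (map s xs) \<union> set (map t ys)" for u
      using that Cons.prems by auto
  qed (use Cons.prems in simp)
  also have "\<dots> = (\<Sum>F\<in>flags. cups (map s ((xs @ [y]) @ ys)) (\<lambda>_. 1) F)"
    using Cons.IH[of "xs @ [y]"] Cons.prems by simp
  finally show ?case
    by simp
qed simp

text \<open>Along a flag on which all tests \<open>std_test T (q, l)\<close> with \<open>l < n - 1\<close> change, these coordinates
  of block \<open>q\<close> stay near 0, which forces coordinate \<open>(q, n - 1)\<close> to stay at \<open>M\<close> or \<open>-M\<close>. By induction
  on \<open>q\<close> the extra summands are therefore constant, and only one flag is left.\<close>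

definition std_sign :: "nat \<times> nat \<Rightarrow> (nat \<times> nat \<Rightarrow> int) \<Rightarrow> bit" where
  "std_sign i v = of_bool (0 < v i \<or> v i = 0 \<and> pos (fst i) v)"

definition std_test :: "(nat \<times> nat \<Rightarrow> nat set) \<Rightarrow> nat \<times> nat \<Rightarrow> (nat \<times> nat \<Rightarrow> int) \<Rightarrow> bit" where
  "std_test T i v = std_sign i v + (\<Sum>p\<in>T i - {fst i}. std_sign (p, n - 1) v)"

text \<open>A zero coordinate borrows the sign of its block, so the rule also holds where the
  coordinate vanishes.\<close>

lemma std_sign_flip:
  assumes "v \<in> cells" "fst i \<in> {1..k}"
  shows "std_sign i (flip S v) = std_sign i v + of_bool (fst i \<in> S)"
  using pos_flip[OF assms, of S] by (auto simp: std_sign_def flip_def)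

text \<open>The coordinates \<open>(p, n - 1)\<close> supply the part of the character that
  coordinate \<open>i\<close> lacks.\<close>

lemma equivariant_std_test:
  assumes "T i \<subseteq> {1..k}" "fst i \<in> T i"
  shows "equivariant (T i) (std_test T i)"
  unfolding equivariant_def
proof (intro ballI allI impI)
  fix v S assume v: "v \<in> cells"
  have fin: "finite (T i)"
    using assms(1) finite_subset by blast
  have "(\<Sum>p\<in>T i - {fst i}. std_sign (p, n - 1) (flip S v)) =
      (\<Sum>p\<in>T i - {fst i}. std_sign (p, n - 1) v + of_bool (p \<in> S))"
    using v assms(1) by (intro sum.cong refl) (auto simp: std_sign_flip subset_iff)
  moreover have "(\<Sum>p\<in>T i. of_bool (p \<in> S) :: bit) = of_bool (fst i \<in> S) + (\<Sum>p\<in>T i - {fst i}. of_bool (p \<in> S))"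
    using fin assms(2) by (rule sum.remove)
  moreover have "std_sign i (flip S v) = std_sign i v + of_bool (fst i \<in> S)"
    using v assms by (intro std_sign_flip) auto
  ultimately show "std_test T i (flip S v) = std_test T i v + (\<Sum>p\<in>T i. of_bool (p \<in> S))"
    by (simp add: std_test_def sum.distrib distrib_left distrib_right add_ac)
qed

text \<open>A coordinate changes at most once along a flag: afterwards it is odd, and
  \<open>cov\<close> alters even coordinates only.\<close>

lemma chain_near:
  assumes "chain F" "t \<le> N"
  shows "(F ! t) i = (F ! 0) i \<or> odd ((F ! t) i) \<and> \<bar>(F ! t) i - (F ! 0) i\<bar> = 1"
  using assms(2)
proof (induction t)
  case (Suc t)
  then have "cov (F ! t) (F ! Suc t)"
    using assms(1) by (simp add: chain_def)
  then show ?case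
    using Suc cov_diff[of "F ! t" "F ! Suc t" i] by auto
qed simp

lemma chain_even_eq: "chain F \<Longrightarrow> t \<le> N \<Longrightarrow> even ((F ! t) i) \<Longrightarrow> (F ! t) i = (F ! 0) i"
  using chain_near by blast

lemma chain_M_eq: "chain F \<Longrightarrow> t \<le> N \<Longrightarrow> \<bar>(F ! t) i\<bar> = M \<Longrightarrow> (F ! t) i = (F ! 0) i"
  using chain_even_eq M(1) by (metis dvd_abs_iff)

text \<open>Steps have length at most 1, so one of the two values is 0; as 0 is even, the coordinate
  still has its initial value there.\<close>

lemma std_sign_crossing_zero:
  assumes "chain F" "t < N" "std_sign i (F ! t) \<noteq> std_sign i (F ! Suc t)"
  shows "(F ! 0) i = 0"
proof -
  have "cov (F ! t) (F ! Suc t)"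
    using assms(1,2) by (simp add: chain_def)
  then have "\<bar>(F ! Suc t) i - (F ! t) i\<bar> \<le> 1"
    using cov_diff[of "F ! t" "F ! Suc t" i] by auto
  then have "(F ! t) i = 0 \<or> (F ! Suc t) i = 0"
    using assms(3) by (auto simp: std_sign_def of_bool_def split: if_splits)
  then show ?thesis
    using chain_near[OF assms(1), of t i] chain_near[OF assms(1), of "Suc t" i] assms(2) by auto
qed

section \<open>The base flag as the only alternating flag\<close>

definition base_vertex :: "nat \<times> nat \<Rightarrow> int" where
  "base_vertex i = (if fst i \<in> {1..k} \<and> snd i = n - 1 then M else 0)"

text \<open>Coordinates move from 0 to -1 and not to 1, because a 0 in a positive block already has
  sign 1.\<close>

definition base_flag :: "(nat \<times> nat) list \<Rightarrow> (nat \<times> nat \<Rightarrow> int) list" where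
  "base_flag idx = map (\<lambda>t i. if i \<in> set (take t idx) then - 1 else base_vertex i) [0..<Suc N]"

context
  fixes idx :: "(nat \<times> nat) list" and T :: "nat \<times> nat \<Rightarrow> nat set"
  assumes idx: "distinct idx" "set idx = {1..k} \<times> {..<n - 1}"
    and T: "\<And>i. i \<in> set idx \<Longrightarrow> T i \<subseteq> {1..fst i}" "\<And>i. i \<in> set idx \<Longrightarrow> fst i \<in> T i"
begin

lemma length_idx: "length idx = N"
  using distinct_card[OF idx(1)] idx(2) by (simp add: N_def)

lemma idxD:
  assumes "i \<in> set idx"
  shows "fst i \<in> {1..k}" "snd i < n - 1"
  using assms unfolding idx(2) by auto

lemma nth_base_flag:
  "t \<le> N \<Longrightarrow> base_flag idx ! t = (\<lambda>i. if i \<in> set (take t idx) then - 1 else base_vertex i)"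
  by (simp add: base_flag_def del: upt_Suc)

lemma base_flag_Suc:
  assumes "t < N"
  shows "base_flag idx ! Suc t = (base_flag idx ! t)(idx ! t := - 1)"
  using assms length_idx by (auto simp: nth_base_flag take_Suc_conv_app_nth fun_eq_iff)

lemma base_flag_nth_idx:
  assumes "t < N"
  shows "(base_flag idx ! t) (idx ! t) = 0"
proof -
  have "idx ! t \<notin> set (take t idx)"
    using assms idx(1) length_idx by (auto simp: in_set_conv_nth nth_eq_iff_index_eq)
  moreover have "idx ! t \<in> set idx"
    using assms length_idx by simp
  ultimately show ?thesis
    using assms idxD[of "idx ! t"] by (simp add: nth_base_flag base_vertex_def)
qed

lemma base_flag_last:
  assumes "t \<le> N" "p \<in> {1..k}"
  shows "(base_flag idx ! t) (p, n - 1) = M"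
  using assms idxD(2)[of "(p, n - 1)"] by (auto simp: nth_base_flag base_vertex_def dest: in_set_takeD)

lemma pos_base_flag:
  assumes "t \<le> N" "p \<in> {1..k}"
  shows "pos p (base_flag idx ! t)"
  unfolding pos_def using base_flag_last[OF assms] n M by (intro exI[of _ "n - 1"]) auto

lemma base_flag_cells:
  assumes "t \<le> N"
  shows "base_flag idx ! t \<in> cells"
proof -
  have "(base_flag idx ! t) i = 0" if "i \<notin> I" for i
  proof -
    have "i \<notin> set (take t idx)"
      using that idxD[of i] n by (auto simp: I_def mem_Times_iff dest: in_set_takeD)
    moreover have "base_vertex i = 0"
      using that n by (auto simp: base_vertex_def I_def mem_Times_iff)
    ultimately show ?thesis
      using assms by (simp add: nth_base_flag)
  qed
  moreover have "\<bar>(base_flag idx ! t) i\<bar> \<le> M" for i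
    using assms M by (auto simp: nth_base_flag base_vertex_def)
  moreover have "\<exists>l<n. \<bar>(base_flag idx ! t) (p, l)\<bar> = M" if "p \<in> {1..k}" for p
    using base_flag_last[OF assms that] n M by (intro exI[of _ "n - 1"]) auto
  ultimately show ?thesis
    unfolding cells_def by blast
qed

lemma base_flag_in_flags: "base_flag idx \<in> flags"
proof -
  have len: "length (base_flag idx) = Suc N"
    by (simp add: base_flag_def)
  have "set (base_flag idx) \<subseteq> cells"
    using base_flag_cells len by (auto simp: in_set_conv_nth less_Suc_eq_le)
  moreover have "even ((base_flag idx ! 0) i)" for i
    using M by (simp add: nth_base_flag base_vertex_def)
  moreover have "cov (base_flag idx ! j) (base_flag idx ! Suc j)" if "j < N" for j
    using that base_flag_cells[of j] base_flag_cells[of "Suc j"] base_flag_nth_idx[of j]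
    by (intro covI[of _ _ "idx ! j"]) (auto simp: base_flag_Suc)
  ultimately show ?thesis
    using len pos_base_flag by (simp add: flags_def chain_def)
qed

definition alternating :: "(nat \<times> nat \<Rightarrow> int) list \<Rightarrow> bool" where
  "alternating F \<longleftrightarrow> (\<forall>j<N. std_test T (idx ! j) (F ! j) \<noteq> std_test T (idx ! j) (F ! Suc j))"

lemma base_flag_alternating: "alternating (base_flag idx)"
  unfolding alternating_def
proof (intro allI impI)
  fix j assume j: "j < N"
  let ?i = "idx ! j" and ?v = "base_flag idx ! j" and ?w = "base_flag idx ! Suc j"
  have i: "?i \<in> set idx"
    using j length_idx by simp
  then have p: "fst ?i \<in> {1..k}"
    using idxD by blast
  have "std_sign ?i ?v = 1" "std_sign ?i ?w = 0"
    using j p base_flag_nth_idx base_flag_Suc pos_base_flag by (auto simp: std_sign_def)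
  moreover have "std_sign (p, n - 1) ?v = std_sign (p, n - 1) ?w" if "p \<in> T ?i - {fst ?i}" for p
  proof -
    have "p \<in> {1..k}"
      using that T(1)[OF i] p by auto
    then show ?thesis
      using base_flag_last[of j p] base_flag_last[of "Suc j" p] j M by (simp add: std_sign_def)
  qed
  then have "(\<Sum>p\<in>T ?i - {fst ?i}. std_sign (p, n - 1) ?v) = (\<Sum>p\<in>T ?i - {fst ?i}. std_sign (p, n - 1) ?w)"
    by (intro sum.cong) auto
  ultimately show "std_test T ?i ?v \<noteq> std_test T ?i ?w"
    by (simp add: std_test_def)
qed

lemma alternating_std_sign:
  assumes "chain F" "alternating F" "j < N"
    and "\<And>p t. p \<in> {1..<fst (idx ! j)} \<Longrightarrow> t \<le> N \<Longrightarrow> \<bar>(F ! t) (p, n - 1)\<bar> = M"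
  shows "std_sign (idx ! j) (F ! j) \<noteq> std_sign (idx ! j) (F ! Suc j)"
proof -
  let ?i = "idx ! j"
  have i: "?i \<in> set idx"
    using assms(3) length_idx by simp
  have "std_sign (p, n - 1) (F ! j) = std_sign (p, n - 1) (F ! Suc j)" if "p \<in> T ?i - {fst ?i}" for p
  proof -
    have "p \<in> {1..<fst ?i}"
      using that T(1)[OF i] by (auto simp: order_le_less)
    note * = assms(4)[OF this]
    have "(F ! j) (p, n - 1) = (F ! 0) (p, n - 1)" "(F ! Suc j) (p, n - 1) = (F ! 0) (p, n - 1)"
      using assms(1,3) * by (auto intro: chain_M_eq)
    moreover have "(F ! 0) (p, n - 1) \<noteq> 0"
      using *[of 0] M by auto
    ultimately show ?thesis
      by (simp add: std_sign_def)
  qed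
  then have "(\<Sum>p\<in>T ?i - {fst ?i}. std_sign (p, n - 1) (F ! j)) = (\<Sum>p\<in>T ?i - {fst ?i}. std_sign (p, n - 1) (F ! Suc j))"
    by (intro sum.cong) auto
  then show ?thesis
    using assms(2,3) by (auto simp: alternating_def std_test_def)
qed

lemma alternating_block:
  assumes "chain F" "alternating F" "q \<in> {1..k}"
  shows "(\<forall>l<n - 1. (F ! 0) (q, l) = 0) \<and> (\<forall>t\<le>N. \<bar>(F ! t) (q, n - 1)\<bar> = M)"
  using assms(3)
proof (induction q rule: less_induct)
  case (less q)
  have zero: "(F ! 0) (q, l) = 0" if l: "l < n - 1" for l
  proof -
    have "(q, l) \<in> set idx"
      using l less.prems idx(2) by simp
    then obtain j where j: "j < N" "idx ! j = (q, l)"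
      using length_idx by (metis in_set_conv_nth)
    have "std_sign (idx ! j) (F ! j) \<noteq> std_sign (idx ! j) (F ! Suc j)"
      using less j by (intro alternating_std_sign[OF assms(1,2)]) auto
    then show ?thesis
      using std_sign_crossing_zero[OF assms(1) j(1)] j(2) by simp
  qed
  moreover have "\<bar>(F ! t) (q, n - 1)\<bar> = M" if t: "t \<le> N" for t
  proof -
    obtain l where l: "l < n" "\<bar>(F ! t) (q, l)\<bar> = M"
      using chain_nth_cells[OF assms(1) t] less.prems unfolding cells_def by blast
    \<comment> \<open>Coordinates before \<open>n - 1\<close> start at 0 and move by at most 1,
      which is less than \<open>M\<close>.\<close>
    have "\<not> l < n - 1"
      using chain_near[OF assms(1) t, of "(q, l)"] zero[of l] l(2) M(2) by auto
    then have "l = n - 1"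
      using l(1) by simp
    then show ?thesis
      using l(2) by simp
  qed
  ultimately show ?case
    by blast
qed

lemma alternating_start:
  assumes "F \<in> flags" "alternating F"
  shows "F ! 0 = base_vertex"
proof
  fix i :: "nat \<times> nat"
  have F: "chain F" "\<And>p. p \<in> {1..k} \<Longrightarrow> pos p (F ! 0)"
    using assms(1) by (auto simp: flags_def)
  note block = alternating_block[OF F(1) assms(2)]
  obtain q l where i: "i = (q, l)"
    by (cases i)
  show "(F ! 0) i = base_vertex i"
  proof (cases "i \<in> I")
    case False
    then show ?thesis
      using cells_outside[OF chain_nth_cells[OF F(1), of 0] False] n i
      by (auto simp: base_vertex_def I_def)
  next
    case True
    then have q: "q \<in> {1..k}" "l < n"
      using i by (auto simp: I_def)
    show ?thesis
    proof (cases "l = n - 1")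
      case True
      obtain l' where l': "l' < n" "0 < (F ! 0) (q, l')"
        using F(2)[OF q(1)] unfolding pos_def by blast
      have "\<not> l' < n - 1"
        using block[OF q(1)] l'(2) by force
      then have "l' = l"
        using l'(1) True by simp
      then have "0 < (F ! 0) (q, l)" "\<bar>(F ! 0) (q, l)\<bar> = M"
        using l' block[OF q(1)] True by auto
      then show ?thesis
        using i q True by (simp add: base_vertex_def)
    next
      case False
      then have "l < n - 1"
        using q(2) by simp
      then show ?thesis
        using block[OF q(1)] i False by (simp add: base_vertex_def)
    qed
  qed
qed

text \<open>The start is fixed; at step \<open>t\<close> the coordinate \<open>idx ! t\<close> is 0
  with sign 1, and only a move to -1 changes its sign.\<close>

lemma alternating_unique:
  assumes "F \<in> flags" "alternating F"
  shows "F = base_flag idx"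
proof -
  have F: "chain F"
    using assms(1) by (auto simp: flags_def)
  note block = alternating_block[OF F assms(2)]
  have "F ! t = base_flag idx ! t" if "t \<le> N" for t
    using that
  proof (induction t)
    case 0
    then show ?case
      using alternating_start[OF assms] by (simp add: nth_base_flag)
  next
    case (Suc t)
    let ?i = "idx ! t"
    have t: "t < N" and IH: "F ! t = base_flag idx ! t"
      using Suc by auto
    have "?i \<in> set idx"
      using t length_idx by simp
    then have p: "fst ?i \<in> {1..k}"
      using idxD by blast
    have zero: "(F ! t) ?i = 0"
      using base_flag_nth_idx[OF t] IH by simp
    have "std_sign ?i (F ! t) = 1"
      using zero pos_base_flag[of t, OF _ p] t IH by (simp add: std_sign_def)
    moreover have "std_sign ?i (F ! t) \<noteq> std_sign ?i (F ! Suc t)"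
      using block p by (intro alternating_std_sign[OF F assms(2) t]) auto
    ultimately have sign: "std_sign ?i (F ! Suc t) = 0"
      by (metis bit_not_one_iff)
    have "(F ! Suc t) (fst ?i, n - 1) = base_vertex (fst ?i, n - 1)"
      using block[OF p] t alternating_start[OF assms] chain_M_eq[OF F, of "Suc t" "(fst ?i, n - 1)"] by simp
    then have "pos (fst ?i) (F ! Suc t)"
      unfolding pos_def using p n M by (intro exI[of _ "n - 1"]) (auto simp: base_vertex_def)
    then have neg: "(F ! Suc t) ?i < 0"
      using sign by (auto simp: std_sign_def)
    have "cov (F ! t) (F ! Suc t)"
      using F t by (simp add: chain_def)
    then obtain a where a: "\<bar>(F ! Suc t) a - (F ! t) a\<bar> = 1" "\<And>j. j \<noteq> a \<Longrightarrow> (F ! Suc t) j = (F ! t) j"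
      by (rule covE) (rule that; blast)
    have "a = ?i"
      using a(2)[of ?i] neg zero by fastforce
    then have "(F ! Suc t) ?i = - 1"
      using a(1) neg zero by auto
    then have "F ! Suc t = (F ! t)(?i := - 1)"
      using a(2) \<open>a = ?i\<close> by (intro ext) auto
    then show ?case
      using base_flag_Suc[OF t] IH by simp
  qed
  then show ?thesis
    using F by (intro nth_equalityI) (auto simp: chain_def base_flag_def less_Suc_eq_le simp del: upt_Suc)
qed

text \<open>For \<open>std_test\<close> exactly one flag has cup product 1. Modulo 2 the count
  depends only on the characters, so it is nonzero for \<open>s\<close> as well.\<close>

theorem exists_crossing_chain:
  assumes "\<And>i. i \<in> set idx \<Longrightarrow> equivariant (T i) (s i)"
  shows "\<exists>F. chain F \<and> (\<forall>i\<in>set idx. \<exists>j<N. s i (F ! j) \<noteq> s i (F ! Suc j))"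
proof -
  have len: "length F = Suc (length idx)" if "F \<in> flags" for F
    using that length_idx by (simp add: flags_def chain_def)
  have alt: "cups (map (std_test T) idx) (\<lambda>_. 1) F = of_bool (F = base_flag idx)" if "F \<in> flags" for F
  proof -
    have "cups (map (std_test T) idx) (\<lambda>_. 1) F = 1 \<longleftrightarrow> alternating F"
      using len[OF that] length_idx by (subst cups_one_iff) (auto simp: alternating_def)
    also have "\<dots> \<longleftrightarrow> F = base_flag idx"
      using alternating_unique[OF that] base_flag_alternating by blast
    finally show ?thesis
      by (metis (full_types) bit_not_one_iff of_bool_eq(1,2))
  qed
  have equiv: "equivariant (T i) (std_test T i)" if "i \<in> set idx" for i
    using T[OF that] idxD(1)[OF that] by (intro equivariant_std_test) auto
  have "(\<Sum>F\<in>flags. cups (map s idx) (\<lambda>_. 1) F) = (\<Sum>F\<in>flags. cups (map (std_test T) idx) (\<lambda>_. 1) F)"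
    using sum_cups_exchange[of "[]" idx T "std_test T" s] assms equiv length_idx by simp
  also have "\<dots> = (\<Sum>F\<in>flags. of_bool (F = base_flag idx))"
    using alt by (intro sum.cong) auto
  also have "\<dots> = 1"
    using base_flag_in_flags finite_flags by (simp add: of_bool_def)
  finally have "(\<Sum>F\<in>flags. cups (map s idx) (\<lambda>_. 1) F) \<noteq> 0"
    by simp
  then obtain F where F: "F \<in> flags" "cups (map s idx) (\<lambda>_. 1) F = 1"
    by (meson bit_not_zero_iff sum.neutral)
  then have *: "\<forall>j<N. s (idx ! j) (F ! j) \<noteq> s (idx ! j) (F ! Suc j)"
    using len[OF F(1)] length_idx by (subst (asm) cups_one_iff) auto
  have "\<exists>j<N. s i (F ! j) \<noteq> s i (F ! Suc j)" if "i \<in> set idx" for i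
    using that * length_idx by (metis in_set_conv_nth)
  then show ?thesis
    using F(1) unfolding flags_def by blast
qed

end

end

section \<open>Common zeros on a product of spheres\<close>

definition sphere_product :: "nat \<Rightarrow> nat \<Rightarrow> (nat \<Rightarrow> nat \<Rightarrow> real) topology" where
  "sphere_product n k = product_topology (\<lambda>_. nsphere (n - 1)) {1..k}"

lemma topspace_sphere_product:
  assumes "1 \<le> n"
  shows "topspace (sphere_product n k) =
    {1..k} \<rightarrow>\<^sub>E {u. (\<forall>l\<ge>n. u l = 0) \<and> (\<Sum>l<n. (u l)\<^sup>2) = 1}"
proof -
  have "topspace (nsphere (n - 1)) = {u. (\<forall>l\<ge>n. u l = 0) \<and> (\<Sum>l<n. (u l)\<^sup>2) = 1}"
    using assms by (auto simp: nsphere_def topspace_Euclidean_space simp flip: lessThan_Suc_atMost)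
  then show ?thesis
    by (simp add: sphere_product_def)
qed

lemma continuous_map_sphere_product_coordinate:
  assumes "p \<in> {1..k}"
  shows "continuous_map (sphere_product n k) euclideanreal (\<lambda>x. x p l)"
  using continuous_map_compose[OF continuous_map_product_projection[OF assms] continuous_map_nsphere_projection]
  unfolding sphere_product_def o_def by fast

lemma normal_space_sphere_product: "normal_space (sphere_product n k)"
proof -
  have "metrizable_space (nsphere (n - 1))"
    unfolding nsphere_def by (intro metrizable_space_subtopology metrizable_Euclidean_space)
  then have "metrizable_space (sphere_product n k)"
    unfolding sphere_product_def metrizable_space_product_topology
    by (simp add: countable_finite)
  then show ?thesis
    by (rule metrizable_imp_normal_space)
qed

lemma limitin_sphere_product:
  assumes "1 \<le> n" "\<And>m. z m \<in> topspace (sphere_product n k)" "x \<in> topspace (sphere_product n k)"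
    and "\<And>p l. p \<in> {1..k} \<Longrightarrow> l < n \<Longrightarrow> (\<lambda>m. z m p l) \<longlonglongrightarrow> x p l"
  shows "limitin (sphere_product n k) z x sequentially"
proof -
  note top = topspace_sphere_product[OF assms(1)]
  have x: "x \<in> extensional {1..k}"
    using assms(3) unfolding top by (auto simp: PiE_iff)
  have "limitin (nsphere (n - 1)) (\<lambda>m. z m p) (x p) sequentially" if p: "p \<in> {1..k}" for p
  proof -
    have z0: "z m p l = 0" if "n \<le> l" for m l
      using assms(2)[of m] that p unfolding top by (auto simp: PiE_iff)
    have x0: "x p l = 0" if "n \<le> l" for l
      using assms(3) that p unfolding top by (auto simp: PiE_iff)
    have lim: "(\<lambda>m. z m p l) \<longlonglongrightarrow> x p l" for l
      using assms(4)[OF p, of l] z0[of l] x0[of l] by (cases "l < n") auto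
    have "z m p \<in> topspace (nsphere (n - 1))" for m
      using assms(2)[of m] p by (auto simp: sphere_product_def)
    moreover have "x p \<in> topspace (nsphere (n - 1))"
      using assms(3) p by (auto simp: sphere_product_def)
    ultimately show ?thesis
      using lim unfolding nsphere limitin_subtopology limitin_componentwise by auto
  qed
  then show ?thesis
    using x assms(2) unfolding sphere_product_def limitin_componentwise by auto
qed

definition sflip :: "nat \<Rightarrow> nat set \<Rightarrow> (nat \<Rightarrow> nat \<Rightarrow> real) \<Rightarrow> nat \<Rightarrow> nat \<Rightarrow> real" where
  "sflip k S x = (\<lambda>p\<in>{1..k}. \<lambda>l. if p \<in> S then - x p l else x p l)"

lemma sflip_eq_sign_action: "sflip k S = sign_action k (\<lambda>p\<in>{1..k}. of_bool (p \<in> S))"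
  by (auto simp: sflip_def sign_action_def fun_eq_iff)

lemma sflip_index_in_carrier: "(\<lambda>p\<in>{1..k}. of_bool (p \<in> S)) \<in> carrier (Z2_power k)"
  by (auto simp: Z2_power_def carrier_integer_mod_group)

lemma sflip_sphere_product:
  assumes "1 \<le> n" "x \<in> topspace (sphere_product n k)"
  shows "sflip k S x \<in> topspace (sphere_product n k)"
proof -
  have "x \<in> {1..k} \<rightarrow>\<^sub>E {u. (\<forall>l\<ge>n. u l = 0) \<and> (\<Sum>l<n. (u l)\<^sup>2) = 1}"
    using assms(2) by (simp only: topspace_sphere_product[OF assms(1)])
  moreover have "(if b then - a else a)\<^sup>2 = a\<^sup>2" for a :: real and b
    by simp
  ultimately have "sflip k S x \<in> {1..k} \<rightarrow>\<^sub>E {u. (\<forall>l\<ge>n. u l = 0) \<and> (\<Sum>l<n. (u l)\<^sup>2) = 1}"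
    by (auto simp: sflip_def PiE_iff)
  then show ?thesis
    by (simp only: topspace_sphere_product[OF assms(1)])
qed

lemma limitin_sflip:
  assumes "1 \<le> n" "\<And>m. z m \<in> topspace (sphere_product n k)" "limitin (sphere_product n k) z x sequentially"
  shows "limitin (sphere_product n k) (\<lambda>m. sflip k S (z m)) (sflip k S x) sequentially"
proof (rule limitin_sphere_product)
  have x: "x \<in> topspace (sphere_product n k)"
    using assms(3) by (simp add: limitin_def)
  then show "sflip k S x \<in> topspace (sphere_product n k)"
    using assms by (intro sflip_sphere_product)
  fix p l assume p: "p \<in> {1..k}"
  have "(\<lambda>m. z m p l) \<longlonglongrightarrow> x p l"
    using continuous_map_limit[OF continuous_map_sphere_product_coordinate[OF p] assms(3), of l]
    by (simp add: o_def)
  then show "(\<lambda>m. sflip k S (z m) p l) \<longlonglongrightarrow> sflip k S x p l"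
    using p by (auto simp: sflip_def intro: tendsto_minus)
qed (use assms sflip_sphere_product in auto)

section \<open>Grid points and their limits\<close>

text \<open>Radial projection of each block, which carries the boundary of the cube to the
  sphere.\<close>

definition sphere_point :: "nat \<Rightarrow> nat \<Rightarrow> (nat \<times> nat \<Rightarrow> real) \<Rightarrow> nat \<Rightarrow> nat \<Rightarrow> real" where
  "sphere_point n k y = (\<lambda>p\<in>{1..k}. \<lambda>l. if l < n then y (p, l) / sqrt (\<Sum>m<n. (y (p, m))\<^sup>2) else 0)"

lemma sphere_point_in_sphere_product:
  assumes "1 \<le> n" "\<And>p. p \<in> {1..k} \<Longrightarrow> 0 < (\<Sum>m<n. (y (p, m))\<^sup>2)"
  shows "sphere_point n k y \<in> topspace (sphere_product n k)"
proof -
  have "(\<Sum>l<n. (sphere_point n k y p l)\<^sup>2) = 1" if p: "p \<in> {1..k}" for p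
  proof -
    let ?s = "\<Sum>m<n. (y (p, m))\<^sup>2"
    have "(\<Sum>l<n. (sphere_point n k y p l)\<^sup>2) = (\<Sum>l<n. (y (p, l))\<^sup>2 / ?s)"
      using p assms(2)[OF p] by (intro sum.cong) (auto simp: sphere_point_def power_divide)
    also have "\<dots> = 1"
      using assms(2)[OF p] by (simp flip: sum_divide_distrib)
    finally show ?thesis .
  qed
  then show ?thesis
    unfolding topspace_sphere_product[OF assms(1)] by (auto simp: PiE_iff sphere_point_def)
qed

text \<open>Integer points and their rescalings by \<open>M\<close> have the same projection; the
  former suit the sign action, the latter suit limits.\<close>

lemma sphere_point_scale:
  assumes "0 < c"
  shows "sphere_point n k (\<lambda>i. y i / c) = sphere_point n k y"
proof -
  have "(\<Sum>m<n. (y (p, m) / c)\<^sup>2) = (\<Sum>m<n. (y (p, m))\<^sup>2) / c\<^sup>2" for p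
    by (simp add: power_divide sum_divide_distrib)
  then show ?thesis
    using assms by (auto simp: sphere_point_def fun_eq_iff real_sqrt_divide)
qed

lemma sphere_point_flip:
  "sphere_point n k (\<lambda>i. real_of_int (flip S v i)) = sflip k S (sphere_point n k (\<lambda>i. real_of_int (v i)))"
proof -
  have "(\<Sum>m<n. (real_of_int (flip S v (p, m)))\<^sup>2) = (\<Sum>m<n. (real_of_int (v (p, m)))\<^sup>2)" for p
    by (intro sum.cong) (auto simp: flip_def)
  then show ?thesis
    by (auto simp: sphere_point_def sflip_def fun_eq_iff flip_def)
qed

text \<open>The lower bound on the norms passes to the limit and keeps the projection away from its
  discontinuity at 0.\<close>

lemma limitin_sphere_point:
  assumes "1 \<le> n" "\<And>m p. p \<in> {1..k} \<Longrightarrow> 1 \<le> (\<Sum>l<n. (y m (p, l))\<^sup>2)"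
    and "\<And>p l. p \<in> {1..k} \<Longrightarrow> l < n \<Longrightarrow> (\<lambda>m. y m (p, l)) \<longlonglongrightarrow> \<xi> (p, l)"
  shows "limitin (sphere_product n k) (\<lambda>m. sphere_point n k (y m)) (sphere_point n k \<xi>) sequentially"
proof -
  have sums: "(\<lambda>m. \<Sum>l<n. (y m (p, l))\<^sup>2) \<longlonglongrightarrow> (\<Sum>l<n. (\<xi> (p, l))\<^sup>2)" if "p \<in> {1..k}" for p
    using that assms(3) by (intro tendsto_sum tendsto_power) auto
  have ge: "1 \<le> (\<Sum>l<n. (\<xi> (p, l))\<^sup>2)" if "p \<in> {1..k}" for p
    using assms(2)[OF that] by (intro LIMSEQ_le_const[OF sums[OF that]]) auto
  show ?thesis
  proof (rule limitin_sphere_product[OF assms(1)])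
    show "sphere_point n k (y m) \<in> topspace (sphere_product n k)" for m
      using assms(2)[of _ m] by (intro sphere_point_in_sphere_product assms(1)) force
    show "sphere_point n k \<xi> \<in> topspace (sphere_product n k)"
      using ge by (intro sphere_point_in_sphere_product assms(1)) force
    fix p l assume pl: "p \<in> {1..k}" "l < n"
    have "(\<lambda>m. y m (p, l) / sqrt (\<Sum>j<n. (y m (p, j))\<^sup>2)) \<longlonglongrightarrow> \<xi> (p, l) / sqrt (\<Sum>j<n. (\<xi> (p, j))\<^sup>2)"
      using ge[OF pl(1)] by (intro tendsto_divide assms(3)[OF pl] tendsto_real_sqrt sums[OF pl(1)]) auto
    then show "(\<lambda>m. sphere_point n k (y m) p l) \<longlonglongrightarrow> sphere_point n k \<xi> p l"
      using pl by (simp add: sphere_point_def)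
  qed
qed

text \<open>Bolzano-Weierstrass, one coordinate after the other.\<close>

lemma common_convergent_subsequence:
  fixes y :: "nat \<Rightarrow> 'a \<Rightarrow> real"
  assumes "finite I" "\<And>m i. i \<in> I \<Longrightarrow> \<bar>y m i\<bar> \<le> B"
  shows "\<exists>r \<xi>. strict_mono (r :: nat \<Rightarrow> nat) \<and> (\<forall>i\<in>I. (\<lambda>m. y (r m) i) \<longlonglongrightarrow> \<xi> i)"
  using assms
proof (induction I rule: finite_induct)
  case empty
  show ?case
    by (intro exI[of _ id]) (auto simp: strict_mono_def)
next
  case (insert j J)
  then obtain r \<xi> where r: "strict_mono r" "\<And>i. i \<in> J \<Longrightarrow> (\<lambda>m. y (r m) i) \<longlonglongrightarrow> \<xi> i"
    by force
  have "bounded (range (\<lambda>m. y (r m) j))"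
    using insert.prems[of j] by (auto simp: bounded_iff intro!: exI[of _ B])
  then obtain l q where q: "strict_mono q" "((\<lambda>m. y (r m) j) \<circ> q) \<longlonglongrightarrow> l"
    using bounded_imp_convergent_subsequence by blast
  have "(\<lambda>m. y ((r \<circ> q) m) i) \<longlonglongrightarrow> (\<xi>(j := l)) i" if "i \<in> insert j J" for i
    using that q r(2)[THEN LIMSEQ_subseq_LIMSEQ, of i q] by (auto simp: o_def)
  then show ?case
    using strict_mono_o[OF r(1) q(1)] by blast
qed

text \<open>Relates the multiplicative form of a character, on reals, to its additive form, on sign
  bits: each factor -1 changes the bit once.\<close>

lemma of_bool_sign_prod:
  fixes c :: real
  assumes "finite T" "c \<noteq> 0"
  shows "of_bool (0 < (\<Prod>p\<in>T. if p \<in> S then - 1 else 1) * c) + (\<Sum>p\<in>T. of_bool (p \<in> S)) = (of_bool (0 < c) :: bit)"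
  using assms
proof (induction T arbitrary: c rule: finite_induct)
  case (insert q T)
  let ?P = "\<Prod>p\<in>T. if p \<in> S then - 1 else (1 :: real)"
  let ?c = "if q \<in> S then - c else c"
  have "(\<Prod>p\<in>insert q T. if p \<in> S then - 1 else 1) * c = ?P * ?c"
    using insert.hyps by simp
  moreover have "of_bool (0 < ?P * ?c) + (\<Sum>p\<in>T. of_bool (p \<in> S)) = (of_bool (0 < ?c) :: bit)"
    using insert.prems by (intro insert.IH) simp
  moreover have "(\<Sum>p\<in>insert q T. of_bool (p \<in> S) :: bit) = of_bool (q \<in> S) + (\<Sum>p\<in>T. of_bool (p \<in> S))"
    using insert.hyps by simp
  ultimately have "of_bool (0 < (\<Prod>p\<in>insert q T. if p \<in> S then - 1 else 1) * c)
      + (\<Sum>p\<in>insert q T. of_bool (p \<in> S)) = of_bool (q \<in> S) + (of_bool (0 < ?c) :: bit)"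
    by (simp only: add.left_commute)
  also have "\<dots> = of_bool (0 < c)"
    using insert.prems by (cases "0 < c") auto
  finally show ?case .
qed auto

text \<open>Near \<open>x\<close> the sign of \<open>H\<close> at a flipped point is that at the
  flip of \<open>x\<close>; adding the character turns it into the sign at \<open>x\<close>,
  whichever flip is taken.\<close>

lemma eventually_test:
  assumes "1 \<le> n" "\<And>m. z m \<in> topspace (sphere_product n k)" "limitin (sphere_product n k) z x sequentially"
    and "continuous_map (sphere_product n k) euclideanreal H" "finite T" "H x \<noteq> 0"
    and "\<And>S. S \<subseteq> {1..k} \<Longrightarrow> H (sflip k S x) = (\<Prod>p\<in>T. if p \<in> S then - 1 else 1) * H x"
    and "\<And>m. A m \<subseteq> {1..k}"
  shows "\<forall>\<^sub>F m in sequentially.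
    of_bool (0 < H (sflip k (A m) (z m))) + (\<Sum>p\<in>T. of_bool (p \<in> A m)) = (of_bool (0 < H x) :: bit)"
proof -
  have "\<forall>\<^sub>F m in sequentially. 0 < H (sflip k S (z m)) \<longleftrightarrow> 0 < H (sflip k S x)" if S: "S \<in> Pow {1..k}" for S
  proof -
    have lim: "(\<lambda>m. H (sflip k S (z m))) \<longlonglongrightarrow> H (sflip k S x)"
      using continuous_map_limit[OF assms(4) limitin_sflip[OF assms(1-3)]] by (simp add: o_def)
    have "H (sflip k S x) \<noteq> 0"
      using assms(5-7) S by simp
    then consider "0 < H (sflip k S x)" | "H (sflip k S x) < 0"
      by linarith
    then show ?thesis
    proof cases
      case 1
      then show ?thesis
        using order_tendstoD(1)[OF lim 1] by (auto elim: eventually_mono)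
    next
      case 2
      then show ?thesis
        using order_tendstoD(2)[OF lim 2] by (auto elim: eventually_mono)
    qed
  qed
  \<comment> \<open>\<open>A m\<close> may vary with \<open>m\<close>, but only finitely many sets
    \<open>S\<close> occur.\<close>
  then have "\<forall>\<^sub>F m in sequentially. \<forall>S\<in>Pow {1..k}. 0 < H (sflip k S (z m)) \<longleftrightarrow> 0 < H (sflip k S x)"
    by (intro eventually_ball_finite) auto
  then show ?thesis
  proof eventually_elim
    case (elim m)
    then have "0 < H (sflip k (A m) (z m)) \<longleftrightarrow> 0 < H (sflip k (A m) x)"
      using assms(8) by blast
    then show ?case
      using of_bool_sign_prod[OF assms(5,6)] assms(7)[OF assms(8)] by simp
  qed
qed

section \<open>Sign tests on the grid\<close>

context cube_grid
begin

definition grid_point :: "(nat \<times> nat \<Rightarrow> int) \<Rightarrow> nat \<Rightarrow> nat \<Rightarrow> real" where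
  "grid_point v = sphere_point n k (\<lambda>i. real_of_int (v i))"

text \<open>Evaluating \<open>H\<close> at the orbit representative makes the sign function exactly equivariant for an
  arbitrary \<open>H\<close>; equivariance of \<open>H\<close> is needed only at the limit point.\<close>

definition test :: "((nat \<Rightarrow> nat \<Rightarrow> real) \<Rightarrow> real) \<Rightarrow> nat set \<Rightarrow> (nat \<times> nat \<Rightarrow> int) \<Rightarrow> bit" where
  "test H T v = of_bool (0 < H (grid_point (flip (neg_blocks v) v))) + (\<Sum>p\<in>T. of_bool (p \<in> neg_blocks v))"

lemma test_eq:
  "test H T v = of_bool (0 < H (sflip k (neg_blocks v) (grid_point v))) + (\<Sum>p\<in>T. of_bool (p \<in> neg_blocks v))"
  by (simp add: test_def grid_point_def sphere_point_flip)

text \<open>All members of an orbit use the same representative, so only the character term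
  changes.\<close>

lemma equivariant_test: "equivariant T (test H T)"
  unfolding equivariant_def
proof (intro ballI allI impI)
  fix v S assume v: "v \<in> cells" and S: "S \<subseteq> {1..k}"
  let ?B = "neg_blocks v"
  have B: "neg_blocks (flip S v) = sym_diff ?B S"
    using v S by (rule neg_blocks_flip)
  have "sym_diff (sym_diff ?B S) S = ?B"
    by blast
  then have "flip (neg_blocks (flip S v)) (flip S v) = flip ?B v"
    by (simp only: B flip_flip)
  moreover have "(of_bool (p \<in> sym_diff ?B S) :: bit) = of_bool (p \<in> ?B) + of_bool (p \<in> S)" for p
    by auto
  ultimately show "test H T (flip S v) = test H T v + (\<Sum>p\<in>T. of_bool (p \<in> S))"
    by (simp only: test_def B sum.distrib add_ac)
qed

lemma cells_norm_ge:
  assumes "v \<in> cells" "p \<in> {1..k}"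
  shows "1 \<le> (\<Sum>l<n. (real_of_int (v (p, l)) / real_of_int M)\<^sup>2)"
proof -
  obtain l where l: "l < n" "\<bar>v (p, l)\<bar> = M"
    using assms unfolding cells_def by blast
  then have "\<bar>real_of_int (v (p, l)) / real_of_int M\<bar> = 1"
    using M by (simp flip: of_int_abs)
  then have "1 = (real_of_int (v (p, l)) / real_of_int M)\<^sup>2"
    by (metis one_power2 power2_abs)
  also have "\<dots> \<le> (\<Sum>l<n. (real_of_int (v (p, l)) / real_of_int M)\<^sup>2)"
    using l(1) by (intro member_le_sum) auto
  finally show ?thesis .
qed

lemma grid_point_eq: "grid_point v = sphere_point n k (\<lambda>i. real_of_int (v i) / real_of_int M)"
  using M sphere_point_scale[of "real_of_int M" n k "\<lambda>i. real_of_int (v i)"] by (simp add: grid_point_def)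

lemma grid_point_in_sphere_product:
  assumes "v \<in> cells"
  shows "grid_point v \<in> topspace (sphere_product n k)"
  unfolding grid_point_eq using cells_norm_ge[OF assms] n
  by (intro sphere_point_in_sphere_product) force+

end

text \<open>Equivariance of \<open>H i\<close> is asked only at \<open>x\<close>, because a Tietze
  extension may fail to be equivariant off the original domain; for such functions it becomes
  available once other zeros have placed \<open>x\<close> in that domain.\<close>

theorem sphere_product_common_zero:
  fixes H :: "nat \<times> nat \<Rightarrow> (nat \<Rightarrow> nat \<Rightarrow> real) \<Rightarrow> real" and T :: "nat \<times> nat \<Rightarrow> nat set"
  assumes n: "1 \<le> n"
    and T: "\<And>i. i \<in> {1..k} \<times> {..<n - 1} \<Longrightarrow> fst i \<in> T i \<and> T i \<subseteq> {1..fst i}"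
    and cont: "\<And>i. i \<in> {1..k} \<times> {..<n - 1} \<Longrightarrow> continuous_map (sphere_product n k) euclideanreal (H i)"
  obtains x where "x \<in> topspace (sphere_product n k)"
    and "\<And>i. i \<in> {1..k} \<times> {..<n - 1} \<Longrightarrow>
      (\<And>S. S \<subseteq> {1..k} \<Longrightarrow> H i (sflip k S x) = (\<Prod>p\<in>T i. if p \<in> S then - 1 else 1) * H i x) \<Longrightarrow> H i x = 0"
proof -
  \<comment> \<open>Even, as the grid requires, and growing, so that the rescaled mesh tends to
    0.\<close>
  define M :: "nat \<Rightarrow> int" where "M m = 2 * (int m + 1)" for m
  have grid: "cube_grid n (M m)" for m
    using n by unfold_locales (auto simp: M_def)
  obtain idx :: "(nat \<times> nat) list" where idx: "set idx = {1..k} \<times> {..<n - 1}" "distinct idx"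
    using finite_distinct_list[of "{1..k} \<times> {..<n - 1}"] by auto
  let ?N = "cube_grid.N n k"
  have "\<exists>F. cube_grid.chain n k (M m) F \<and>
      (\<forall>i\<in>set idx. \<exists>j<?N. cube_grid.test n k (H i) (T i) (F ! j) \<noteq> cube_grid.test n k (H i) (T i) (F ! Suc j))" for m
  proof (rule cube_grid.exists_crossing_chain[OF grid idx(2,1), where T = T])
    show "cube_grid.equivariant n k (M m) (T i) (cube_grid.test n k (H i) (T i))" for i
      by (rule cube_grid.equivariant_test[OF grid])
  qed (use T idx(1) in blast)+
  then obtain F where F: "\<And>m. cube_grid.chain n k (M m) (F m)"
    and cross: "\<And>m i. i \<in> set idx \<Longrightarrow>
      \<exists>j<?N. cube_grid.test n k (H i) (T i) (F m ! j) \<noteq> cube_grid.test n k (H i) (T i) (F m ! Suc j)"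
    by metis
  define y where "y t m i = real_of_int ((F m ! t) i) / real_of_int (M m)" for t m i
  have Mpos: "0 < M m" for m
    by (simp add: M_def)
  have cells: "F m ! t \<in> cube_grid.cells n k (M m)" if "t \<le> ?N" for m t
    by (rule cube_grid.chain_nth_cells[OF grid F that])
  have "\<bar>y 0 m i\<bar> \<le> 1" for m i
  proof -
    have "\<bar>(F m ! 0) i\<bar> \<le> M m"
      by (rule cube_grid.cells_Le[OF grid cells]) simp
    then have "\<bar>real_of_int ((F m ! 0) i)\<bar> \<le> real_of_int (M m)"
      by (simp flip: of_int_abs)
    then show ?thesis
      using Mpos[of m] by (simp add: y_def divide_le_eq)
  qed
  then have "\<exists>r \<xi>. strict_mono (r :: nat \<Rightarrow> nat) \<and> (\<forall>i\<in>{1..k} \<times> {..<n}. (\<lambda>m. y 0 (r m) i) \<longlonglongrightarrow> \<xi> i)"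
    by (intro common_convergent_subsequence) auto
  then obtain r :: "nat \<Rightarrow> nat" and \<xi> where r: "strict_mono r"
    and \<xi>: "\<And>i. i \<in> {1..k} \<times> {..<n} \<Longrightarrow> (\<lambda>m. y 0 (r m) i) \<longlonglongrightarrow> \<xi> i"
    by blast
  define x where "x = sphere_point n k \<xi>"
  have point: "cube_grid.grid_point n k (F m ! t) = sphere_point n k (y t m)" for m t
    unfolding y_def by (rule cube_grid.grid_point_eq[OF grid])
  \<comment> \<open>Cells of a flag differ from its first vertex by at most 1 in each coordinate, or
    \<open>1 / M\<close> after rescaling, so every choice of positions \<open>t m\<close> leads to
    the same limit.\<close>
  have near: "(\<lambda>m. y (t m) (r m) i - y 0 (r m) i) \<longlonglongrightarrow> 0" if t: "\<And>m. t m \<le> ?N" for t i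
  proof (rule Lim_null_comparison)
    show "\<forall>\<^sub>F m in sequentially. norm (y (t m) (r m) i - y 0 (r m) i) \<le> inverse (real (Suc m))"
    proof (intro always_eventually allI)
      fix m
      have "\<bar>(F (r m) ! t m) i - (F (r m) ! 0) i\<bar> \<le> 1"
        using cube_grid.chain_near[OF grid F t, of "r m" m i] by auto
      then have "\<bar>real_of_int ((F (r m) ! t m) i) - real_of_int ((F (r m) ! 0) i)\<bar> \<le> 1"
        by linarith
      then have "\<bar>y (t m) (r m) i - y 0 (r m) i\<bar> \<le> 1 / real_of_int (M (r m))"
        using Mpos[of "r m"] by (simp add: y_def divide_le_cancel flip: diff_divide_distrib)
      also have "\<dots> \<le> 1 / real (Suc m)"
        using seq_suble[OF r, of m] by (intro divide_left_mono) (auto simp: M_def)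
      finally show "norm (y (t m) (r m) i - y 0 (r m) i) \<le> inverse (real (Suc m))"
        by (simp add: inverse_eq_divide)
    qed
  qed (rule LIMSEQ_inverse_real_of_nat)
  have limit: "limitin (sphere_product n k) (\<lambda>m. cube_grid.grid_point n k (F (r m) ! t m)) x sequentially"
    if t: "\<And>m. t m \<le> ?N" for t
    unfolding point x_def
  proof (rule limitin_sphere_point[OF n])
    show "1 \<le> (\<Sum>l<n. (y (t m) (r m) (p, l))\<^sup>2)" if "p \<in> {1..k}" for m p
      unfolding y_def by (rule cube_grid.cells_norm_ge[OF grid cells[OF t] that])
    show "(\<lambda>m. y (t m) (r m) (p, l)) \<longlonglongrightarrow> \<xi> (p, l)" if "p \<in> {1..k}" "l < n" for p l
      using tendsto_add[OF near[where t = t and i = "(p, l)", OF t] \<xi>[of "(p, l)"]] that by simp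
  qed
  show ?thesis
  proof (rule that[of x])
    show "x \<in> topspace (sphere_product n k)"
      using limit[of "\<lambda>_. 0"] by (simp add: limitin_def)
  next
    fix i assume i: "i \<in> {1..k} \<times> {..<n - 1}"
      and equiv: "\<And>S. S \<subseteq> {1..k} \<Longrightarrow> H i (sflip k S x) = (\<Prod>p\<in>T i. if p \<in> S then - 1 else 1) * H i x"
    show "H i x = 0"
    proof (rule ccontr)
      assume nz: "H i x \<noteq> 0"
      let ?test = "cube_grid.test n k (H i) (T i)"
      have "\<exists>j<?N. ?test (F (r m) ! j) \<noteq> ?test (F (r m) ! Suc j)" for m
        using cross i idx(1) by blast
      \<comment> \<open>The sign changes at step \<open>j m\<close>, but both ends of this step
        converge to \<open>x\<close> and eventually have the same sign.\<close>
      then obtain j where j: "\<And>m. j m < ?N" "\<And>m. ?test (F (r m) ! j m) \<noteq> ?test (F (r m) ! Suc (j m))"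
        by metis
      have ev: "\<forall>\<^sub>F m in sequentially. ?test (F (r m) ! t m) = of_bool (0 < H i x)"
        if t: "\<And>m. t m \<le> ?N" for t
        unfolding cube_grid.test_eq[OF grid]
      proof (rule eventually_test[OF n _ limit[OF t] cont[OF i] _ nz equiv])
        show "cube_grid.grid_point n k (F (r m) ! t m) \<in> topspace (sphere_product n k)" for m
          by (rule cube_grid.grid_point_in_sphere_product[OF grid cells[OF t]])
        show "finite (T i)"
          using T[OF i] finite_subset by blast
        show "cube_grid.neg_blocks n k (F (r m) ! t m) \<subseteq> {1..k}" for m
          by (auto simp: cube_grid.neg_blocks_def[OF grid])
      qed
      have "\<forall>\<^sub>F m in sequentially. ?test (F (r m) ! j m) = ?test (F (r m) ! Suc (j m))"
        using ev[of j] ev[of "\<lambda>m. Suc (j m)"] j(1) by (auto simp: less_imp_le Suc_leI elim: eventually_elim2)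
      then show False
        using j(2) by (auto simp: eventually_sequentially)
    qed
  qed
qed

section \<open>Application to the Stiefel manifold\<close>

theorem theorem1p1:
  fixes n k :: nat and f :: "(nat \<Rightarrow> nat \<Rightarrow> real) \<Rightarrow> nat \<Rightarrow> nat \<Rightarrow> real"
  assumes "1 \<le> k" and "k \<le> n"
    and "continuous_map (Stiefel n k) (Stiefel_target n k) f"
    and "Z2_equivariant k (topspace (Stiefel n k)) f"
  shows "\<exists>x\<in>topspace (Stiefel n k). f x = (\<lambda>j\<in>{1..k}. \<lambda>l. 0)"
proof -
  define V where "V = topspace (Stiefel n k)"
  define D where "D = {x :: nat \<Rightarrow> nat \<Rightarrow> real. \<forall>i\<in>{1..k}. \<forall>j\<in>{1..k}. i \<noteq> j \<longrightarrow> (\<Sum>l<n. x i l * x j l) = 0}"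
  define dot where "dot p q x = (\<Sum>l<n. x p l * x q l)" for p q and x :: "nat \<Rightarrow> nat \<Rightarrow> real"
  have n: "1 \<le> n"
    using assms by simp
  let ?X = "sphere_product n k"
  have Stiefel: "Stiefel n k = subtopology ?X D"
    by (simp add: Stiefel_def sphere_product_def D_def)
  then have V: "V = topspace ?X \<inter> D"
    by (simp add: V_def)
  have cont_dot: "continuous_map ?X euclideanreal (dot p q)" if "p \<in> {1..k}" "q \<in> {1..k}" for p q
    unfolding dot_def using that
    by (intro continuous_map_sum continuous_map_real_mult continuous_map_sphere_product_coordinate) auto
  have closed: "closedin ?X V"
  proof -
    let ?Z = "\<lambda>(p, q). {x \<in> topspace ?X. dot p q x \<in> {0}}"
    let ?P = "{(p, q) \<in> {1..k} \<times> {1..k}. p \<noteq> q}"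
    have "closedin ?X (?Z (p, q))" if "p \<in> {1..k}" "q \<in> {1..k}" for p q
      unfolding case_prod_conv by (rule closedin_continuous_map_preimage[OF cont_dot[OF that]]) simp
    \<comment> \<open>The whole space joins the family, which would be empty for
      \<open>k = 1\<close>.\<close>
    then have "closedin ?X (\<Inter> (insert (topspace ?X) (?Z ` ?P)))"
      by (intro closedin_Inter) auto
    also have "\<Inter> (insert (topspace ?X) (?Z ` ?P)) = V"
      unfolding V D_def dot_def by auto
    finally show ?thesis .
  qed
  have fV: "f x \<in> topspace (Stiefel_target n k)" if "x \<in> V" for x
    using assms(3) that unfolding V_def by (auto simp: continuous_map_def)
  have "\<exists>g. continuous_map ?X euclideanreal g \<and> (\<forall>x\<in>V. g x = f x j l)" if j: "j \<in> {1..k}" for j l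
  proof -
    have "continuous_map (Stiefel_target n k) (Euclidean_space (n - j)) (\<lambda>x. x j)"
      unfolding Stiefel_target_def by (rule continuous_map_product_projection[OF j])
    then have "continuous_map (Stiefel n k) (Euclidean_space (n - j)) (\<lambda>x. f x j)"
      using continuous_map_compose[OF assms(3)] by (fastforce simp: o_def)
    moreover have "continuous_map (Euclidean_space (n - j)) euclideanreal (\<lambda>u. u l)"
      unfolding Euclidean_space_def
      by (intro continuous_map_from_subtopology continuous_map_product_projection) simp
    ultimately have "continuous_map (Stiefel n k) euclideanreal (\<lambda>x. f x j l)"
      using continuous_map_compose by (fastforce simp: o_def)
    moreover have "Stiefel n k = subtopology ?X V"
      unfolding V Stiefel by (simp add: subtopology_restrict)
    ultimately have "continuous_map (subtopology ?X V) euclideanreal (\<lambda>x. f x j l)"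
      by simp
    then show ?thesis
      using Tietze_extension_realinterval[OF normal_space_sphere_product closed is_interval_univ UNIV_not_empty _ subset_UNIV]
      by metis
  qed
  then obtain g where g: "\<And>j l. j \<in> {1..k} \<Longrightarrow> continuous_map ?X euclideanreal (g j l)"
    "\<And>j l x. j \<in> {1..k} \<Longrightarrow> x \<in> V \<Longrightarrow> g j l x = f x j l"
    by metis
  \<comment> \<open>For fixed \<open>q\<close>, the values \<open>l < n - q\<close> carry the
    components of the \<open>q\<close>-th entry of \<open>f\<close>; the others, from
    \<open>n - q\<close> to \<open>n - 2\<close>, carry the inner products of vectors
    \<open>p\<close> and \<open>q\<close>, with \<open>p = l + q + 1 - n\<close> running from 1 to
    \<open>q - 1\<close>.\<close>
  define T where "T i = (if snd i < n - fst i then {fst i} else {snd i + fst i + 1 - n, fst i})" for i :: "nat \<times> nat"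
  define H where "H i = (if snd i < n - fst i then g (fst i) (snd i) else dot (snd i + fst i + 1 - n) (fst i))"
    for i :: "nat \<times> nat"
  have range: "snd i + fst i + 1 - n \<in> {1..<fst i}"
    if "i \<in> {1..k} \<times> {..<n - 1}" "\<not> snd i < n - fst i" for i
    using that assms(2) by auto
  obtain x where x: "x \<in> topspace ?X"
    and zero: "\<And>i. i \<in> {1..k} \<times> {..<n - 1} \<Longrightarrow>
      (\<And>S. S \<subseteq> {1..k} \<Longrightarrow> H i (sflip k S x) = (\<Prod>p\<in>T i. if p \<in> S then - 1 else 1) * H i x) \<Longrightarrow> H i x = 0"
  proof (rule sphere_product_common_zero[OF n, where T = T and H = H and k = k])
    fix i assume i: "i \<in> {1..k} \<times> {..<n - 1}"
    show "fst i \<in> T i \<and> T i \<subseteq> {1..fst i}"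
      using range[OF i] i by (auto simp: T_def)
    show "continuous_map ?X euclideanreal (H i)"
    proof (cases "snd i < n - fst i")
      case True
      then show ?thesis
        using g(1) i by (auto simp: H_def)
    next
      case False
      then show ?thesis
        using range[OF i False] i by (auto simp: H_def intro!: cont_dot)
    qed
  qed blast
  \<comment> \<open>Inner products are equivariant everywhere, so their zeros come first and put
    \<open>x\<close> into \<open>V\<close>.\<close>
  have dot0: "dot p q x = 0" if pq: "1 \<le> p" "p < q" "q \<le> k" for p q
  proof -
    \<comment> \<open>The second entry solves \<open>l + q + 1 - n = p\<close> for
      \<open>l\<close>.\<close>
    define i where "i = (q, n + p - q - 1)"
    have i: "i \<in> {1..k} \<times> {..<n - 1}" "\<not> snd i < n - fst i" "snd i + fst i + 1 - n = p"
      using pq assms(2) by (auto simp: i_def)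
    have "H i (sflip k S x) = (\<Prod>p\<in>T i. if p \<in> S then - 1 else 1) * H i x" for S
    proof -
      have "dot p q (sflip k S x) = (\<Prod>p\<in>{p, q}. if p \<in> S then - 1 else 1) * dot p q x"
        using pq by (auto simp: dot_def sflip_def sum_negf)
      then show ?thesis
        using i(2,3) by (simp add: H_def T_def i_def)
    qed
    then have "H i x = 0"
      using zero[OF i(1)] by blast
    then show ?thesis
      using i(2,3) by (simp add: H_def i_def)
  qed
  have "x \<in> D"
    unfolding D_def
  proof (intro CollectI ballI impI)
    fix p q assume "p \<in> {1..k}" "q \<in> {1..k}" "p \<noteq> q"
    then have "dot p q x = 0 \<or> dot q p x = 0"
      using dot0[of p q] dot0[of q p] by (auto simp: linorder_neq_iff)
    then show "(\<Sum>l<n. x p l * x q l) = 0"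
      by (auto simp: dot_def mult.commute)
  qed
  then have xV: "x \<in> V"
    using x V by simp
  \<comment> \<open>With \<open>x\<close> in \<open>V\<close>, the equivariance of \<open>f\<close>
    applies at \<open>x\<close> and passes to the extensions \<open>g\<close> there.\<close>
  have equiv: "f (sflip k S x) = sflip k S (f x)" for S
    using assms(4) xV sflip_index_in_carrier unfolding Z2_equivariant_def V_def sflip_eq_sign_action by blast
  have f0: "f x q l = 0" if q: "q \<in> {1..k}" for q l
  proof (cases "l < n - q")
    case True
    define i where "i = (q, l)"
    have i: "i \<in> {1..k} \<times> {..<n - 1}"
      using True q by (auto simp: i_def)
    have "H i (sflip k S x) = (\<Prod>p\<in>T i. if p \<in> S then - 1 else 1) * H i x" for S
    proof -
      have "sflip k S x \<in> V"
        using sign_action_Stiefel[OF n] xV unfolding V_def sflip_eq_sign_action by blast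
      then have "g q l (sflip k S x) = sflip k S (f x) q l"
        using g(2)[OF q] equiv by simp
      also have "\<dots> = (if q \<in> S then - 1 else 1) * g q l x"
        using q g(2)[OF q xV] by (simp add: sflip_def)
      finally show ?thesis
        using True by (simp add: H_def T_def i_def)
    qed
    then have "H i x = 0"
      using zero[OF i] by blast
    then show ?thesis
      using True g(2)[OF q xV] by (simp add: H_def i_def)
  next
    \<comment> \<open>From \<open>n - q\<close> on, coordinates vanish throughout the
      target.\<close>
    case False
    then show ?thesis
      using fV[OF xV] q by (auto simp: Stiefel_target_def topspace_Euclidean_space PiE_iff)
  qed
  have "f x \<in> extensional {1..k}"
    using fV[OF xV] by (auto simp: Stiefel_target_def PiE_iff)
  then have "f x = (\<lambda>j\<in>{1..k}. \<lambda>l. 0)"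
    using f0 by (auto simp: fun_eq_iff extensional_def)
  then show ?thesis
    using xV unfolding V_def by blast
qed

end
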